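(* Let $X$ be a linearly recurrent subshift and let $\mu$ be its unique invariant probability measure. Then the spectral triple $(C_\infty(X),L^2(X,\mu),D_X)$ has finite Connes distance, and the topology induced by the Connes distance on the state space of $C(X)$ is the weak-$*$ topology.
   Context: Let $\mathcal{A}$ be a finite set and $\sigma$ the left shift on $\mathcal{A}^{\mathbb{Z}}$, $\sigma(x)_n=x_{n+1}$. A subshift is a non-empty closed set $X\subseteq\mathcal{A}^{\mathbb{Z}}$ with $\sigma(X)=X$; it is minimal if every $\sigma$-orbit in $X$ is dense. For $n\ge1$, $X_n=\{(x_1,\dots,x_n):x\in X\}$; such finite words are called admissible, and $|w|$ denotes the length of a word $w$. If $w$ is an admissible word, a right return word to $w$ is a word $r$ such that $rw$ is admissible, $w$ is a prefix of $rw$, and there are exactly two (possibly overlapping) occurrences of $w$ in $rw$. A minimal subshift $X$ is linearly recurrent if there exists a constant $K$ such that for all $n\ge1$, any $w\in X_n$ and any right return word $r$ to $w$, $|r|\le K|w|$. A linearly recurrent subshift has a unique $\sigma$-invariant probability measure (a known result), and its support is $X$. Spectral triple. For $w\in X_n$, $U(w)=\{x\in X:(x_{-m},\dots,x_m)=w\}$ if $n=2m+1$, and $U(w)=\{x\in X:(x_{1-m},\dots,x_m)=w\}$ if $n=2m\ge2$; $\xi(w)$ is the characteristic function of $U(w)$. Set $C_{-1}=\{0\}$, $C_0=\mathbb{C}1$, $C_n=\mathrm{span}\{\xi(w):w\in X_n\}$ for $n\ge1$, viewed both in $C(X)$ and in $L^2(X,\mu)$; $C_\infty(X)=\bigcup_nC_n$,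 acting on $L^2(X,\mu)$ by multiplication. $D_X$ is the operator on $L^2(X,\mu)$ with domain $\{\sum_{n\ge0}\xi_n:\xi_n\in C_n\cap C_{n-1}^\perp,\ \sum_n(n\|\xi_n\|)^2<\infty\}$ and $D_X\xi=n\xi$ for $\xi\in C_n\cap C_{n-1}^\perp$, $n\ge0$. For every $f\in C_\infty(X)$, $[D_X,f]$ extends to a bounded operator, whose norm is denoted $\|[D_X,f]\|$. Connes metric (distance). On the state space of $C(X)$, $d(\phi,\psi)=\sup\{|\phi(f)-\psi(f)|: f\in C_\infty(X),\ \|[D_X,f]\|\le1\}\in[0,\infty]$. It is called finite if $d(\phi,\psi)<\infty$ for all states $\phi,\psi$. *)

theory Defs
  imports "HOL-Analysis.Analysis" "HOL-Probability.Probability" "HOL-Library.Sublist"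
begin

definition full_shift :: "'a set \<Rightarrow> (int \<Rightarrow> 'a) topology" where
  "full_shift A = product_topology (\<lambda>_. discrete_topology A) UNIV"

definition shift :: "(int \<Rightarrow> 'a) \<Rightarrow> (int \<Rightarrow> 'a)" where
  "shift x = (\<lambda>n. x (n + 1))"

definition orbit :: "(int \<Rightarrow> 'a) \<Rightarrow> (int \<Rightarrow> 'a) set" where
  \<comment> \<open>the two-sided orbit: the \<open>n\<close>-th power of the shift sends \<open>x\<close> to \<open>\<lambda>i. x (i + n)\<close>\<close>
  "orbit x = {(\<lambda>i. x (i + n)) | n. True}"

definition subshift :: "'a set \<Rightarrow> (int \<Rightarrow> 'a) set \<Rightarrow> bool" where
  "subshift A X \<longleftrightarrow> X \<noteq> {} \<and> closedin (full_shift A) X \<and> shift ` X = X"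

abbreviation subshift_top :: "'a set \<Rightarrow> (int \<Rightarrow> 'a) set \<Rightarrow> (int \<Rightarrow> 'a) topology" where
  "subshift_top A X \<equiv> subtopology (full_shift A) X"

definition minimal_subshift :: "'a set \<Rightarrow> (int \<Rightarrow> 'a) set \<Rightarrow> bool" where
  "minimal_subshift A X \<longleftrightarrow>
     subshift A X \<and> (\<forall>x\<in>X. subshift_top A X closure_of orbit x = X)"

definition words :: "(int \<Rightarrow> 'a) set \<Rightarrow> nat \<Rightarrow> 'a list set" where
  "words X n = {map x [1..int n] | x. x \<in> X}"

definition admissible :: "(int \<Rightarrow> 'a) set \<Rightarrow> 'a list \<Rightarrow> bool" where
  "admissible X w \<longleftrightarrow> (\<exists>n\<ge>1. w \<in> words X n)"

definition occurrences :: "'a list \<Rightarrow> 'a list \<Rightarrow> nat set" where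
  "occurrences w v = {i. i + length w \<le> length v \<and> take (length w) (drop i v) = w}"

definition right_return_word :: "(int \<Rightarrow> 'a) set \<Rightarrow> 'a list \<Rightarrow> 'a list \<Rightarrow> bool" where
  "right_return_word X w r \<longleftrightarrow>
     admissible X (r @ w) \<and> prefix w (r @ w) \<and> card (occurrences w (r @ w)) = 2"

definition linearly_recurrent :: "'a set \<Rightarrow> (int \<Rightarrow> 'a) set \<Rightarrow> bool" where
  "linearly_recurrent A X \<longleftrightarrow> minimal_subshift A X \<and>
     (\<exists>K::real. \<forall>n\<ge>1. \<forall>w\<in>words X n. \<forall>r. right_return_word X w r \<longrightarrow>
        real (length r) \<le> K * real (length w))"

definition invariant_prob_measure ::
    "'a set \<Rightarrow> (int \<Rightarrow> 'a) set \<Rightarrow> (int \<Rightarrow> 'a) measure \<Rightarrow> bool" where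
  "invariant_prob_measure A X M \<longleftrightarrow>
     prob_space M \<and> space M = X \<and> sets M = sigma_sets X {U. openin (subshift_top A X) U} \<and>
     (\<forall>B\<in>sets M. emeasure M (shift -` B \<inter> X) = emeasure M B)"

text \<open>
  A function on \<open>X\<close> is represented by a total function.  Members of \<open>C(X)\<close> are required to vanish
  off \<open>X\<close>, so that each continuous function on \<open>X\<close> has exactly one representative; the constant
  function 1 is thus \<open>indicator X\<close>.
\<close>

definition cont_functions :: "'a set \<Rightarrow> (int \<Rightarrow> 'a) set \<Rightarrow> ((int \<Rightarrow> 'a) \<Rightarrow> complex) set" where
  "cont_functions A X =
     {f. continuous_map (subshift_top A X) euclidean f \<and> (\<forall>x. x \<notin> X \<longrightarrow> f x = 0)}"

definition cylinder :: "(int \<Rightarrow> 'a) set \<Rightarrow> 'a list \<Rightarrow> (int \<Rightarrow> 'a) set" where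
  "cylinder X w = (let m = int (length w div 2) in
     if odd (length w) then {x\<in>X. map x [-m..m] = w} else {x\<in>X. map x [1-m..m] = w})"

text \<open>The filtration \<open>C\<^sub>n\<close>, \<open>n \<ge> -1\<close>.  For a finite alphabet \<open>words X n\<close> is finite, so the sums
  below are exactly the elements of the complex span.\<close>

definition cyl_space :: "(int \<Rightarrow> 'a) set \<Rightarrow> int \<Rightarrow> ((int \<Rightarrow> 'a) \<Rightarrow> complex) set" where
  "cyl_space X n =
     (if n < 0 then {\<lambda>_. 0}
      else if n = 0 then {(\<lambda>x. c * indicator X x) | c. True}
      else {(\<lambda>x. \<Sum>w\<in>words X (nat n). c w * indicator (cylinder X w) x) | c. True})"

definition cyl_functions :: "(int \<Rightarrow> 'a) set \<Rightarrow> ((int \<Rightarrow> 'a) \<Rightarrow> complex) set" where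
  "cyl_functions X = (\<Union>n\<in>{-1..}. cyl_space X n)"

text \<open>Elements of \<open>L\<^sup>2\<close> are represented by square-integrable functions; \<open>l2_norm\<close> is then a
  seminorm, vanishing exactly on the functions that are zero almost everywhere.  The graph
  of \<open>D\<^sub>X\<close> below is closed under (measurable) changes on null sets, and hence
  represents the graph of an operator on the space of equivalence classes.\<close>

definition L2 :: "'b measure \<Rightarrow> ('b \<Rightarrow> complex) set" where
  "L2 M = {f \<in> borel_measurable M. integrable M (\<lambda>x. (cmod (f x))\<^sup>2)}"

definition l2_inner :: "'b measure \<Rightarrow> ('b \<Rightarrow> complex) \<Rightarrow> ('b \<Rightarrow> complex) \<Rightarrow> complex" where
  "l2_inner M f g = (LINT x|M. f x * cnj (g x))"

definition l2_norm :: "'b measure \<Rightarrow> ('b \<Rightarrow> complex) \<Rightarrow> real" where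
  "l2_norm M f = sqrt (LINT x|M. (cmod (f x))\<^sup>2)"

definition l2_orth :: "'b measure \<Rightarrow> ('b \<Rightarrow> complex) set \<Rightarrow> ('b \<Rightarrow> complex) set" where
  "l2_orth M S = {f \<in> L2 M. \<forall>g\<in>S. l2_inner M f g = 0}"

definition l2_sums :: "'b measure \<Rightarrow> (nat \<Rightarrow> 'b \<Rightarrow> complex) \<Rightarrow> ('b \<Rightarrow> complex) \<Rightarrow> bool" where
  "l2_sums M s f \<longleftrightarrow> f \<in> L2 M \<and>
     (\<lambda>N. l2_norm M (\<lambda>x. f x - (\<Sum>n<N. s n x))) \<longlonglongrightarrow> 0"

text \<open>The unbounded operator \<open>D\<^sub>X\<close>, given by its graph.\<close>

definition dirac ::
    "(int \<Rightarrow> 'a) set \<Rightarrow> (int \<Rightarrow> 'a) measure \<Rightarrow>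
     (((int \<Rightarrow> 'a) \<Rightarrow> complex) \<times> ((int \<Rightarrow> 'a) \<Rightarrow> complex)) set" where
  "dirac X M = {(\<xi>, \<eta>). \<exists>s.
     (\<forall>n::nat. s n \<in> cyl_space X (int n) \<inter> l2_orth M (cyl_space X (int n - 1))) \<and>
     summable (\<lambda>n. (real n * l2_norm M (s n))\<^sup>2) \<and>
     l2_sums M s \<xi> \<and> l2_sums M (\<lambda>n x. of_nat n * s n x) \<eta>}"

text \<open>The norm of \<open>[D\<^sub>X, f]\<close>, for \<open>f\<close> in \<open>cyl_functions X\<close>, as a supremum over the unit ball of the
  (dense) domain of \<open>D\<^sub>X\<close>, which is mapped into itself by multiplication with \<open>f\<close>.\<close>

definition commutator_norm ::
    "(int \<Rightarrow> 'a) set \<Rightarrow> (int \<Rightarrow> 'a) measure \<Rightarrow> ((int \<Rightarrow> 'a) \<Rightarrow> complex) \<Rightarrow> ennreal" where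
  "commutator_norm X M f =
     (SUP (\<xi>, \<eta>, \<zeta>) \<in> {(\<xi>, \<eta>, \<zeta>). (\<xi>, \<eta>) \<in> dirac X M \<and> (\<lambda>x. f x * \<xi> x, \<zeta>) \<in> dirac X M \<and>
                              l2_norm M \<xi> \<le> 1}.
        ennreal (l2_norm M (\<lambda>x. \<zeta> x - f x * \<eta> x)))"

text \<open>States are extensional functions on \<open>C(X)\<close>, so that equality of states is equality on \<open>C(X)\<close>
  and the states form a subset of the product space indexed by \<open>C(X)\<close>.\<close>

definition states ::
    "'a set \<Rightarrow> (int \<Rightarrow> 'a) set \<Rightarrow> (((int \<Rightarrow> 'a) \<Rightarrow> complex) \<Rightarrow> complex) set" where
  "states A X = {\<phi> \<in> extensional (cont_functions A X).
     (\<forall>f\<in>cont_functions A X. \<forall>g\<in>cont_functions A X. \<phi> (\<lambda>x. f x + g x) = \<phi> f + \<phi> g) \<and>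
     (\<forall>c. \<forall>f\<in>cont_functions A X. \<phi> (\<lambda>x. c * f x) = c * \<phi> f) \<and>
     (\<forall>f\<in>cont_functions A X. (\<forall>x\<in>X. f x \<in> \<real>\<^sub>\<ge>\<^sub>0) \<longrightarrow> \<phi> f \<in> \<real>\<^sub>\<ge>\<^sub>0) \<and>
     \<phi> (indicator X) = 1}"

definition weak_star_topology ::
    "'a set \<Rightarrow> (int \<Rightarrow> 'a) set \<Rightarrow> (((int \<Rightarrow> 'a) \<Rightarrow> complex) \<Rightarrow> complex) topology" where
  "weak_star_topology A X =
     subtopology (product_topology (\<lambda>_. euclidean) (cont_functions A X)) (states A X)"

definition connes_dist ::
    "(int \<Rightarrow> 'a) set \<Rightarrow> (int \<Rightarrow> 'a) measure \<Rightarrow> (((int \<Rightarrow> 'a) \<Rightarrow> complex) \<Rightarrow> complex) \<Rightarrow>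
     (((int \<Rightarrow> 'a) \<Rightarrow> complex) \<Rightarrow> complex) \<Rightarrow> ennreal" where
  "connes_dist X M \<phi> \<psi> =
     (SUP f \<in> {f \<in> cyl_functions X. commutator_norm X M f \<le> 1}. ennreal (cmod (\<phi> f - \<psi> f)))"

end

theory Submission imports Defs begin

text \<open>
  Write \<open>avg n f\<close> for the conditional expectation of \<open>f\<close> onto \<open>C\<^sub>n\<close>, which is the orthogonal projection
  onto \<open>C\<^sub>n\<close> in \<open>L\<^sup>2\<close>: on a cell (a cylinder of length \<open>n\<close>) it is the mean of \<open>f\<close> over that cell.
  The whole theorem rests on one estimate: the functions \<open>f\<close> with \<open>\<parallel>[D\<^sub>X, f]\<parallel> \<le> 1\<close> are approximated
  by \<open>avg N f\<close> in the supremum norm, uniformly in \<open>f\<close>, with an error that tends to 0 as \<open>N\<close> grows.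

  Applying the commutator to the constant function 1, which \<open>D\<^sub>X\<close> kills, gives \<open>\<parallel>D\<^sub>X f\<parallel> \<le> 1\<close>, that is,
  \<open>\<Sum>j j\<^sup>2 \<parallel>D j\<parallel>\<^sup>2 \<le> 1\<close> for the increments \<open>D j = avg j f - avg (j - 1) f\<close>
  (\<open>commutator_norm_imp_increments\<close>).  By linear recurrence a cell of
  length \<open>j\<close> has measure at least \<open>1 / (R j)\<close> (\<open>measure_cell_ge\<close>), so \<open>\<bar>D j x\<bar>\<^sup>2 \<le> R j \<parallel>D j\<parallel>\<^sup>2\<close>.  Moreover
  \<open>D j x\<close> vanishes unless the cell of \<open>x\<close> really shrinks from length \<open>j - 1\<close> to length \<open>j\<close>.  The
  Cauchy-Schwarz inequality then bounds the squared error \<open>\<bar>f x - avg N f x\<bar>\<^sup>2\<close> by \<open>R\<close> times the sum of \<open>1 / j\<close>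
  over those \<open>j > N\<close> at which the cell of \<open>x\<close> splits (\<open>pointwise_deviation\<close>).

  That sum is small because splittings are rare (\<open>sum_splits_small\<close>).  If the central words of \<open>x\<close>
  can be continued in two ways at several radii in \<open>[N, 2N)\<close>, then each of them has a right special
  suffix (or a left special prefix) of a common length \<open>L\<close>.  The complexity is at most linear, so \<open>L\<close> can be
  chosen in \<open>[N, 2N)\<close> with a bounded number of special words of length \<open>L\<close>.  Two radii with the same
  special word produce a repetition of that word in \<open>x\<close>, and a repetition of a word of length \<open>L\<close> at a distance much
  smaller than \<open>L\<close> would force the whole set to have too few words, unless \<open>X\<close> is finite and splittings
  stop altogether.  Hence every dyadic block contains a bounded number of
  splittings, and the sum over the splittings beyond \<open>N\<close> is \<open>O(1 / N)\<close>.

  Given the estimate, finiteness follows because all states agree on constants.  For the topologies, two elementary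
  comparisons suffice.  Every function in \<open>C\<^sub>n\<close> of small enough norm has commutator norm at most 1, since on
  \<open>C\<^sub>n\<close> the commutator is a sum of \<open>n\<close> commutators with projections (\<open>commutator_norm_le_1_if_small\<close>);
  as the \<open>C\<^sub>n\<close> are dense in \<open>C(X)\<close>, evaluation at any continuous function is continuous for the Connes distance.
  Conversely, up to a small error the distance only tests the finitely many cell indicators of one fixed
  length \<open>N\<close>, with bounded coefficients (\<open>weak_star_neighbourhood_in_mball\<close>).
\<close>

section \<open>Words of linearly recurrent sets of sequences\<close>

definition factor :: "(int \<Rightarrow> 'a) \<Rightarrow> int \<Rightarrow> nat \<Rightarrow> 'a list" where
  "factor x i n = map (\<lambda>k. x (i + int k)) [0..<n]"

definition factors :: "(int \<Rightarrow> 'a) set \<Rightarrow> nat \<Rightarrow> 'a list set" where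
  "factors X n = (\<lambda>x. factor x 0 n) ` X"

definition right_special :: "(int \<Rightarrow> 'a) set \<Rightarrow> nat \<Rightarrow> 'a list set" where
  "right_special X n =
     {w. \<exists>x\<in>X. \<exists>y\<in>X. factor x 0 n = w \<and> factor y 0 n = w \<and> x (int n) \<noteq> y (int n)}"

definition right_splits :: "(int \<Rightarrow> 'a) set \<Rightarrow> (int \<Rightarrow> 'a) \<Rightarrow> nat set" where
  "right_splits X x =
     {m. \<exists>y\<in>X. (\<forall>i. \<bar>i\<bar> \<le> int m \<longrightarrow> y i = x i) \<and> y (int m + 1) \<noteq> x (int m + 1)}"

lemma length_factor [simp]: "length (factor x i n) = n"
  by (simp add: factor_def)

lemma factor_eq_iff:
  "factor x i n = factor y j n \<longleftrightarrow> (\<forall>k<n. x (i + int k) = y (j + int k))"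
  by (auto simp: factor_def)

lemma factor_translate: "factor (\<lambda>k. x (k + i)) j n = factor x (j + i) n"
  by (simp add: factor_eq_iff add_ac)

lemma factor_Suc: "factor x i (Suc n) = factor x i n @ [x (i + int n)]"
  by (simp add: factor_def)

lemma right_special_subset: "right_special X n \<subseteq> factors X n"
  by (auto simp: right_special_def factors_def)

text \<open>The form of linear recurrence used throughout: every word of length \<open>n\<close> starts in every stretch of
  \<open>R * n\<close> consecutive positions.  By translation invariance it is enough to say this for the stretch that starts at 0 and for
  words read at 0.  Unlike the condition on return words, this form is visibly
  symmetric under reflection of \<open>\<int>\<close>.\<close>

locale linearly_recurrent_words =
  fixes X :: "(int \<Rightarrow> 'a) set" and R :: nat
  assumes nonempty: "X \<noteq> {}"
    and translate: "x \<in> X \<Longrightarrow> (\<lambda>i. x (i + k)) \<in> X"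
    and recurrence: "x \<in> X \<Longrightarrow> y \<in> X \<Longrightarrow> 0 < n \<Longrightarrow> \<exists>k<R * n. \<forall>i<n. x (int k + int i) = y (int i)"
begin

lemma R_pos: "0 < R"
  using nonempty recurrence[of _ _ 1] by fastforce

lemma factors_subset_occurring:
  assumes "x \<in> X" "0 < n"
  shows "factors X n \<subseteq> (\<lambda>k. factor x (int k) n) ` {..<R * n}"
proof
  fix w assume "w \<in> factors X n"
  then obtain y where y: "y \<in> X" "w = factor y 0 n"
    by (auto simp: factors_def)
  from recurrence[OF assms(1) y(1) assms(2)]
  obtain k where "k < R * n" "\<forall>i<n. x (int k + int i) = y (int i)" by blast
  then show "w \<in> (\<lambda>k. factor x (int k) n) ` {..<R * n}"
    using y(2) by (auto simp: factor_eq_iff intro!: image_eqI[of _ _ k])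
qed

lemma finite_factors: "finite (factors X n)"
proof (cases "n = 0")
  case True
  then show ?thesis by (simp add: factors_def factor_def image_constant_conv)
next
  case False
  obtain x where "x \<in> X" using nonempty by blast
  then show ?thesis
    using factors_subset_occurring[of x n] False finite_surj[of "{..<R * n}"] by blast
qed

lemma card_factors_le:
  assumes "0 < n"
  shows "card (factors X n) \<le> R * n"
proof -
  obtain x where "x \<in> X" using nonempty by blast
  then have "card (factors X n) \<le> card ((\<lambda>k. factor x (int k) n) ` {..<R * n})"
    using factors_subset_occurring[of x n] assms by (intro card_mono) auto
  also have "\<dots> \<le> R * n"
    using card_image_le[of "{..<R * n}" "\<lambda>k. factor x (int k) n"] by simp
  finally show ?thesis .
qed

lemma finite_right_special: "finite (right_special X n)"
  using finite_subset[OF right_special_subset finite_factors] .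

lemma factor_in_right_special:
  assumes "x \<in> X" "y \<in> X" "\<forall>k<n. x (i + int k) = y (i + int k)"
    and "x (i + int n) \<noteq> y (i + int n)"
  shows "factor x i n \<in> right_special X n"
proof -
  have "factor (\<lambda>k. x (k + i)) 0 n = factor x i n" "factor (\<lambda>k. y (k + i)) 0 n = factor x i n"
    using assms(3) by (auto simp: factor_translate factor_eq_iff)
  then show ?thesis
    unfolding right_special_def using translate[OF assms(1), of i] translate[OF assms(2), of i] assms(4)
    by (intro CollectI bexI[of _ "\<lambda>k. x (k + i)"] bexI[of _ "\<lambda>k. y (k + i)"])
       (auto simp: add_ac)
qed

text \<open>Every word has an extension by one letter, and a right special one has a second extension.\<close>

lemma card_factors_Suc:
  "card (factors X n) + card (right_special X n) \<le> card (factors X (Suc n))"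
proof -
  have "\<forall>w\<in>factors X n. \<exists>x. x \<in> X \<and> factor x 0 n = w"
    by (auto simp: factors_def)
  then obtain p where p: "\<And>w. w \<in> factors X n \<Longrightarrow> p w \<in> X \<and> factor (p w) 0 n = w"
    by metis
  have "\<forall>w\<in>right_special X n. \<exists>x. x \<in> X \<and> factor x 0 n = w \<and> x (int n) \<noteq> p w (int n)"
    unfolding right_special_def by clarsimp metis
  then obtain q where q: "\<And>w. w \<in> right_special X n \<Longrightarrow>
      q w \<in> X \<and> factor (q w) 0 n = w \<and> q w (int n) \<noteq> p w (int n)"
    by metis
  define e where "e w = factor (p w) 0 (Suc n)" for w
  define e' where "e' w = factor (q w) 0 (Suc n)" for w
  have e: "e w = w @ [p w (int n)]" if "w \<in> factors X n" for w
    using p[OF that] by (simp add: e_def factor_Suc)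
  have e': "e' w = w @ [q w (int n)]" if "w \<in> right_special X n" for w
    using q[OF that] by (simp add: e'_def factor_Suc)
  have disj: "e ` factors X n \<inter> e' ` right_special X n = {}"
    using e e' q by fastforce
  have "inj_on e (factors X n)" "inj_on e' (right_special X n)"
    by (auto intro!: inj_onI simp: e e')
  then have "card (factors X n) + card (right_special X n)
      = card (e ` factors X n \<union> e' ` right_special X n)"
    using disj by (subst card_Un_disjoint) (auto simp: finite_factors finite_right_special card_image)
  also have "\<dots> \<le> card (factors X (Suc n))"
    using p q by (intro card_mono finite_factors) (auto simp: factors_def e_def e'_def)
  finally show ?thesis .
qed

lemma sum_card_right_special_le:
  "(\<Sum>L = m..<m + k. card (right_special X L)) \<le> card (factors X (m + k))"
proof (induction k)
  case (Suc k)
  then show ?case using card_factors_Suc[of "m + k"] by simp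
qed simp

text \<open>The easy half of the Morse-Hedlund theorem.  The hypothesis excludes exactly the
  periodic case, in which splittings stop altogether.\<close>

lemma card_factors_gt:
  assumes "\<And>L. right_special X L \<noteq> {}"
  shows "n < card (factors X n)"
proof (induction n)
  case 0
  show ?case using finite_factors[of 0] nonempty by (auto simp: card_gt_0_iff factors_def)
next
  case (Suc n)
  have "0 < card (right_special X n)"
    using assms finite_right_special by (simp add: card_gt_0_iff)
  then show ?case using Suc card_factors_Suc[of n] by linarith
qed

text \<open>The hypothesis on \<open>x\<close> says that the word of length \<open>n\<close> at \<open>i\<close> is repeated at distance \<open>d\<close>.
  Then \<open>x\<close> has period \<open>d\<close> on a stretch of length \<open>n + d\<close>, which shows at most \<open>d\<close> words of length \<open>d\<close>.
  If \<open>n \<ge> R * d\<close>, recurrence makes all words of length \<open>d\<close> visible there, although there are more than \<open>d\<close> of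
  them.\<close>

lemma repetition_length_less:
  assumes special: "\<And>L. right_special X L \<noteq> {}"
    and x: "x \<in> X" and d: "0 < d"
    and rep: "\<And>k. k < n \<Longrightarrow> x (i + int d + int k) = x (i + int k)"
  shows "n < R * d"
proof (rule ccontr)
  assume "\<not> n < R * d"
  then have n: "R * d \<le> n" by simp
  define z where "z k = x (k + i)" for k
  have z: "z \<in> X" using translate[OF x, of i] by (simp add: z_def[abs_def])
  have periodic: "z (int t) = z (int (t mod d))" if "t < n + d" for t
    using that
  proof (induction t rule: less_induct)
    case (less t)
    show ?case
    proof (cases "t < d")
      case False
      have "z (int t) = z (int (t - d))"
        using rep[of "t - d"] False less.prems by (simp add: z_def of_nat_diff algebra_simps)
      also have "\<dots> = z (int ((t - d) mod d))"
        using less.IH[of "t - d"] less.prems False d by simp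
      finally show ?thesis using False by (simp add: le_mod_geq)
    qed simp
  qed
  have "factors X d \<subseteq> (\<lambda>k. factor z (int k) d) ` {..<d}"
  proof
    fix w assume "w \<in> factors X d"
    then obtain k where k: "k < R * d" "w = factor z (int k) d"
      using factors_subset_occurring[OF z d] by auto
    have "z (int k + int j) = z (int (k mod d) + int j)" if "j < d" for j
    proof -
      have "k mod d + j \<le> k + j" by simp
      then have "k + j < n + d" "k mod d + j < n + d" using that k(1) n by linarith+
      then show ?thesis
        using periodic[of "k + j"] periodic[of "k mod d + j"] by (simp add: mod_add_left_eq)
    qed
    then have "w = factor z (int (k mod d)) d"
      using k(2) by (simp add: factor_eq_iff)
    then show "w \<in> (\<lambda>k. factor z (int k) d) ` {..<d}" using d by auto
  qed
  then have "card (factors X d) \<le> d"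
    using surj_card_le[of "{..<d}"] by fastforce
  then show False using card_factors_gt[OF special, of d] by simp
qed

text \<open>Pigeonhole: a splitting radius \<open>m\<close> is determined by the right special word of length \<open>L\<close> that
  ends at \<open>m\<close> together with the position of \<open>m\<close> among \<open>R\<close> equal blocks of \<open>[N, 2N)\<close>, since two radii
  with the same special word are at distance more than \<open>L / R \<ge> N / R\<close>.\<close>

lemma card_right_splits_le:
  assumes special: "\<And>L. right_special X L \<noteq> {}"
    and x: "x \<in> X" and N: "0 < N"
  shows "card (right_splits X x \<inter> {N..<2 * N}) \<le> 2 * R * R"
proof -
  \<comment> \<open>The numbers of right special words of the lengths in \<open>[N, 2N)\<close> sum to at most the number of
        words of length \<open>2N\<close>, which is at most \<open>2 * R * N\<close>.\<close>
  have "\<exists>L\<in>{N..<N + N}. card (right_special X L) \<le> 2 * R"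
  proof (rule ccontr)
    assume "\<not> ?thesis"
    then have "(\<Sum>L = N..<N + N. 2 * R) < (\<Sum>L = N..<N + N. card (right_special X L))"
      using N by (intro sum_strict_mono) (auto simp: not_le)
    also have "\<dots> \<le> R * (N + N)"
      using sum_card_right_special_le[of N N] card_factors_le[of "N + N"] N by linarith
    finally show False by simp
  qed
  then obtain L where L: "N \<le> L" "L < 2 * N" "card (right_special X L) \<le> 2 * R" by auto
  define T where "T = right_splits X x \<inter> {N..<2 * N}"
  define w where "w m = factor x (int m + 1 - int L) L" for m
  define g where "g m = (w m, R * (m - N) div N)" for m
  have "g ` T \<subseteq> right_special X L \<times> {..<R}"
  proof
    fix v assume "v \<in> g ` T"
    then obtain m where m: "m \<in> T" "v = g m" by blast
    then obtain y where y: "y \<in> X" "\<And>i. \<bar>i\<bar> \<le> int m \<Longrightarrow> y i = x i"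
        "y (int m + 1) \<noteq> x (int m + 1)" and mN: "N \<le> m" "m < 2 * N"
      by (auto simp: T_def right_splits_def)
    have "w m \<in> right_special X L"
      unfolding w_def using y L mN by (intro factor_in_right_special[OF x y(1)]) (auto simp: eq_commute)
    moreover have "R * (m - N) div N < R"
      using mN R_pos N by (simp add: div_less_iff_less_mult)
    ultimately show "v \<in> right_special X L \<times> {..<R}" by (simp add: m g_def)
  qed
  moreover have "inj_on g T"
  proof -
    have sep: "g m \<noteq> g m'" if "m < m'" "m \<in> T" "m' \<in> T" for m m'
    proof
      assume eq: "g m = g m'"
      have mN: "N \<le> m" using that by (auto simp: T_def)
      have "L < R * (m' - m)"
      proof (rule repetition_length_less[OF special x])
        fix k assume "k < L"
        have "w m = w m'" using eq by (simp add: g_def)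
        then have "x (int m + 1 - int L + int k) = x (int m' + 1 - int L + int k)"
          using \<open>k < L\<close> by (simp add: w_def factor_eq_iff)
        then show "x (int m + 1 - int L + int (m' - m) + int k) = x (int m + 1 - int L + int k)"
          using that by (simp add: of_nat_diff algebra_simps)
      qed (use that in simp)
      moreover have "R * (m' - N) = R * (m - N) + R * (m' - m)"
        using mN that by (simp flip: add_mult_distrib2)
      ultimately have "R * (m - N) + N \<le> R * (m' - N)" using L by linarith
      then have "R * (m - N) div N + 1 \<le> R * (m' - N) div N"
        using N div_le_mono[of "R * (m - N) + N" "R * (m' - N)" N] by simp
      then show False using eq by (simp add: g_def)
    qed
    show ?thesis
    proof (rule inj_onI)
      fix m m' assume "m \<in> T" "m' \<in> T" "g m = g m'"
      then show "m = m'" using sep[of m m'] sep[of m' m] by (cases m m' rule: linorder_cases) auto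
    qed
  qed
  ultimately have "card T \<le> card (right_special X L \<times> {..<R})"
    using finite_right_special by (metis card_inj_on_le finite_SigmaI finite_lessThan)
  also have "\<dots> \<le> 2 * R * R" using L(3) by (simp add: card_cartesian_product)
  finally show ?thesis by (simp add: T_def)
qed

text \<open>If some length has no right special words, splittings stop there.  Otherwise each dyadic block \<open>[2\<^sup>k N, 2\<^sup>k\<^sup>+\<^sup>1 N)\<close> contributes at most \<open>2 R\<^sup>2 / (2\<^sup>k N)\<close>, a geometric series.\<close>

lemma sum_right_splits_le:
  "\<exists>B N0. \<forall>x\<in>X. \<forall>N n. N0 \<le> N \<longrightarrow> 0 < N \<longrightarrow>
     (\<Sum>m\<in>right_splits X x \<inter> {N..<n}. 1 / real m) \<le> B / real N"
proof (cases "\<exists>L. right_special X L = {}")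
  case True
  then obtain L where L: "right_special X L = {}" by blast
  have "right_splits X x \<inter> {N..<n} = {}" if "x \<in> X" "L \<le> N" for x N n
  proof (rule equals0I)
    fix m assume "m \<in> right_splits X x \<inter> {N..<n}"
    then obtain y where y: "y \<in> X" "\<And>i. \<bar>i\<bar> \<le> int m \<Longrightarrow> y i = x i"
        "y (int m + 1) \<noteq> x (int m + 1)" and "N \<le> m"
      by (auto simp: right_splits_def)
    then have "factor x (int m + 1 - int L) L \<in> right_special X L"
      using that by (intro factor_in_right_special[OF that(1) y(1)]) (auto simp: eq_commute)
    then show False using L by blast
  qed
  then show ?thesis by (intro exI[of _ 0] exI[of _ L]) auto
next
  case False
  then have special: "\<And>L. right_special X L \<noteq> {}" by blast
  define B where "B = real (2 * R * R)"
  have dyadic: "(\<Sum>m\<in>right_splits X x \<inter> {N..<2 ^ k * N}. 1 / real m) \<le> B / real N * (2 - 2 / 2 ^ k)"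
    if x: "x \<in> X" and N: "0 < N" for x N k
  proof (induction k)
    case (Suc k)
    let ?S = "right_splits X x" and ?M = "2 ^ k * N"
    have M: "0 < ?M" using N by simp
    have "N \<le> ?M" "?M \<le> 2 * ?M" by simp_all
    then have "{N..<2 ^ Suc k * N} = {N..<?M} \<union> {?M..<2 * ?M}"
      unfolding power_Suc mult.assoc by (rule ivl_disj_un_two(3)[symmetric])
    then have "(\<Sum>m\<in>?S \<inter> {N..<2 ^ Suc k * N}. 1 / real m)
        = (\<Sum>m\<in>?S \<inter> {N..<?M}. 1 / real m) + (\<Sum>m\<in>?S \<inter> {?M..<2 * ?M}. 1 / real m)"
      by (simp only: Int_Un_distrib) (rule sum.union_disjoint; auto)
    also have "(\<Sum>m\<in>?S \<inter> {?M..<2 * ?M}. 1 / real m) \<le> real (card (?S \<inter> {?M..<2 * ?M})) * (1 / real ?M)"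
    proof (rule sum_bounded_above)
      fix m assume "m \<in> ?S \<inter> {?M..<2 * ?M}"
      then have "?M \<le> m" by simp
      then have "real ?M \<le> real m" by (rule of_nat_mono)
      moreover have "0 < real ?M" using M by (simp only: of_nat_0_less_iff)
      ultimately show "1 / real m \<le> 1 / real ?M" by (intro divide_left_mono) auto
    qed
    also have "\<dots> \<le> B * (1 / real ?M)"
      unfolding B_def using card_right_splits_le[OF special x M]
      by (intro mult_right_mono of_nat_mono) auto
    also have "(\<Sum>m\<in>?S \<inter> {N..<?M}. 1 / real m) \<le> B / real N * (2 - 2 / 2 ^ k)" by (rule Suc.IH)
    finally show ?case using N by (simp add: field_simps)
  qed simp
  have "(\<Sum>m\<in>right_splits X x \<inter> {N..<n}. 1 / real m) \<le> 2 * B / real N"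
    if x: "x \<in> X" and N: "0 < N" for x N n
  proof -
    have "n \<le> 2 ^ n * N" using N less_exp[of n]
      by (metis One_nat_def Suc_leI less_imp_le_nat le_trans mult.right_neutral mult_le_mono2)
    then have "(\<Sum>m\<in>right_splits X x \<inter> {N..<n}. 1 / real m)
        \<le> (\<Sum>m\<in>right_splits X x \<inter> {N..<2 ^ n * N}. 1 / real m)"
      by (intro sum_mono2) auto
    also have "\<dots> \<le> B / real N * (2 - 2 / 2 ^ n)" by (rule dyadic[OF x N])
    also have "\<dots> \<le> B / real N * 2"
      by (intro mult_left_mono) (auto simp: B_def)
    finally show ?thesis by (simp add: mult.commute)
  qed
  then show ?thesis by (intro exI[of _ "2 * B"] exI[of _ 0]) simp
qed

end

text \<open>Reflection turns continuations to the left into continuations to the right, so left splittings need no argument of their own.\<close>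

lemma linearly_recurrent_words_reverse:
  assumes "linearly_recurrent_words X R"
  shows "linearly_recurrent_words ((\<lambda>x i. x (- i)) ` X) R"
proof -
  interpret linearly_recurrent_words X R by fact
  show ?thesis
  proof
    show "(\<lambda>x i. x (- i)) ` X \<noteq> {}" using nonempty by simp
  next
    fix x k assume "x \<in> (\<lambda>x i. x (- i)) ` X"
    then obtain u where u: "u \<in> X" "x = (\<lambda>i. u (- i))" by auto
    show "(\<lambda>i. x (i + k)) \<in> (\<lambda>x i. x (- i)) ` X"
      using translate[OF u(1), of "-k"] u(2) by (intro image_eqI[of _ _ "\<lambda>i. u (i + - k)"]) auto
  next
    fix x y and n :: nat assume "x \<in> (\<lambda>x i. x (- i)) ` X" "y \<in> (\<lambda>x i. x (- i)) ` X" and n: "0 < n"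
    then obtain u v where u: "u \<in> X" "x = (\<lambda>i. u (- i))" and v: "v \<in> X" "y = (\<lambda>i. v (- i))" by auto
    \<comment> \<open>Read from right to left, the stretch of length \<open>R * n + n - 1\<close> at 0 in \<open>x\<close> is the one at \<open>2 - R * n - n\<close> in \<open>u\<close>.\<close>
    define u' where "u' = (\<lambda>i. u (i + (2 - int (R * n) - int n)))"
    define v' where "v' = (\<lambda>i. v (i + (1 - int n)))"
    have "u' \<in> X" "v' \<in> X"
      unfolding u'_def v'_def by (rule translate[OF u(1)], rule translate[OF v(1)])
    then obtain j where j: "j < R * n" "\<forall>i<n. u' (int j + int i) = v' (int i)"
      using recurrence[of u' v' n] n by auto
    show "\<exists>k<R * n. \<forall>i<n. x (int k + int i) = y (int i)"
    proof (intro exI[of _ "R * n - 1 - j"] conjI allI impI)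
      show "R * n - 1 - j < R * n" using j(1) by simp
    next
      fix i assume i: "i < n"
      define m where "m = R * n"
      have pos: "- (int (m - 1 - j) + int i) = int j + int (n - 1 - i) + (2 - int m - int n)"
          "- int i = int (n - 1 - i) + (1 - int n)"
        using j(1) i by (auto simp: m_def[symmetric] of_nat_diff)
      have "x (int (R * n - 1 - j) + int i) = u (- (int (m - 1 - j) + int i))"
        by (simp only: u(2) m_def)
      also have "\<dots> = u' (int j + int (n - 1 - i))"
        unfolding pos(1) by (simp only: u'_def m_def)
      also have "\<dots> = v' (int (n - 1 - i))"
        by (rule j(2)[rule_format]) (use i in simp)
      also have "\<dots> = v (- int i)"
        by (simp only: pos(2) v'_def)
      finally show "x (int (R * n - 1 - j) + int i) = y (int i)"
        by (simp only: v(2))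
    qed
  qed
qed

text \<open>The coordinates prescribed by a cylinder of length \<open>n\<close>: \<open>[-m, m]\<close> for \<open>n = 2m + 1\<close> and
  \<open>[1 - m, m]\<close> for \<open>n = 2m\<close>.  For \<open>n = 0\<close> the window is empty, which fits \<open>C\<^sub>0\<close>.\<close>

definition window :: "nat \<Rightarrow> int set" where
  "window n = {1 - int ((n + 1) div 2)..int (n div 2)}"

definition cell :: "(int \<Rightarrow> 'a) set \<Rightarrow> nat \<Rightarrow> (int \<Rightarrow> 'a) \<Rightarrow> (int \<Rightarrow> 'a) set" where
  "cell X n x = {y \<in> X. \<forall>i\<in>window n. y i = x i}"

lemma window_mono: "m \<le> n \<Longrightarrow> window m \<subseteq> window n"
  by (auto simp: window_def)

lemma cell_mono: "m \<le> n \<Longrightarrow> cell X n x \<subseteq> cell X m x"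
  using window_mono by (fastforce simp: cell_def)

text \<open>Passing from odd length \<open>2m + 1\<close> the window grows to the right, from even length to the left.
  A splitting at length \<open>2m + 1\<close> is a right splitting of \<open>x\<close> at radius \<open>m\<close>; one at length \<open>2m + 2\<close> is a right
  splitting at radius \<open>m\<close> of the reflected sequence.\<close>

lemma (in linearly_recurrent_words) sum_splits_small:
  assumes "0 < (\<epsilon>::real)"
  shows "\<exists>N. \<forall>x\<in>X. \<forall>n. (\<Sum>j | N \<le> j \<and> j < n \<and> cell X (Suc j) x \<noteq> cell X j x. 1 / real (Suc j)) \<le> \<epsilon>"
proof -
  define X' where "X' = (\<lambda>x i. x (- i)) ` X"
  interpret rev: linearly_recurrent_words X' R
    unfolding X'_def by (rule linearly_recurrent_words_reverse) unfold_locales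
  from sum_right_splits_le obtain B1 N1 where B1: "\<And>x N n. x \<in> X \<Longrightarrow> N1 \<le> N \<Longrightarrow> 0 < N \<Longrightarrow>
     (\<Sum>m\<in>right_splits X x \<inter> {N..<n}. 1 / real m) \<le> B1 / real N" by blast
  from rev.sum_right_splits_le obtain B2 N2 where B2: "\<And>x N n. x \<in> X' \<Longrightarrow> N2 \<le> N \<Longrightarrow> 0 < N \<Longrightarrow>
     (\<Sum>m\<in>right_splits X' x \<inter> {N..<n}. 1 / real m) \<le> B2 / real N" by blast
  obtain N3 where N3: "(\<bar>B1\<bar> + \<bar>B2\<bar>) / \<epsilon> < real N3" using reals_Archimedean2 by blast
  define N where "N = Suc (max N1 (max N2 N3))"
  have N: "N1 \<le> N" "N2 \<le> N" "0 < N" "N3 \<le> N" by (auto simp: N_def)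
  have small: "B1 / real N + B2 / real N \<le> \<epsilon>"
  proof -
    have "(\<bar>B1\<bar> + \<bar>B2\<bar>) / \<epsilon> \<le> real N" using N3 N(4) by linarith
    then have "\<bar>B1\<bar> + \<bar>B2\<bar> \<le> \<epsilon> * real N" using assms by (simp add: field_simps)
    then have "B1 + B2 \<le> \<epsilon> * real N" by linarith
    then show ?thesis using N(3) by (simp add: field_simps)
  qed
  show ?thesis
  proof (intro exI[of _ "2 * N + 1"] ballI allI)
    fix x n assume x: "x \<in> X"
    define x' where "x' = (\<lambda>i. x (- i))"
    have x': "x' \<in> X'" using x by (auto simp: X'_def x'_def)
    define S where "S = {j. 2 * N + 1 \<le> j \<and> j < n \<and> cell X (Suc j) x \<noteq> cell X j x}"
    define S1 where "S1 = right_splits X x \<inter> {N..<n}"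
    define S2 where "S2 = right_splits X' x' \<inter> {N..<n}"
    have "S \<subseteq> (\<lambda>m. 2 * m + 1) ` S1 \<union> (\<lambda>m. 2 * m + 2) ` S2"
    proof
      fix j assume "j \<in> S"
      then have j: "2 * N + 1 \<le> j" "j < n" "cell X (Suc j) x \<noteq> cell X j x" by (auto simp: S_def)
      then obtain y where y: "y \<in> X" "\<And>i. i \<in> window j \<Longrightarrow> y i = x i" "\<exists>i\<in>window (Suc j). y i \<noteq> x i"
        using cell_mono[of j "Suc j" X x] by (auto simp: cell_def)
      show "j \<in> (\<lambda>m. 2 * m + 1) ` S1 \<union> (\<lambda>m. 2 * m + 2) ` S2"
      proof (cases "odd j")
        case True
        then obtain m where m: "j = 2 * m + 1" by (elim oddE)
        have wj: "window j = {- int m..int m}" "window (Suc j) = insert (int m + 1) (window j)"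
          unfolding window_def m by auto
        have "m \<in> S1"
          unfolding S1_def right_splits_def
        proof (intro IntI CollectI bexI[of _ y] conjI allI impI)
          show "y (int m + 1) \<noteq> x (int m + 1)" using y wj by auto
          show "m \<in> {N..<n}" using j m by auto
          fix i assume "\<bar>i\<bar> \<le> int m"
          then show "y i = x i" using y(2)[of i] by (auto simp: wj abs_le_iff)
        qed (rule y(1))
        then show ?thesis using m by blast
      next
        case False
        then obtain k where k: "j = 2 * k" by (auto elim: evenE)
        obtain m where m: "k = Suc m" using j(1) k by (cases k) auto
        have wj: "window j = {- int m..int m + 1}" "window (Suc j) = insert (- int m - 1) (window j)"
          unfolding window_def k m by auto
        have d: "y (- int m - 1) \<noteq> x (- int m - 1)" using y wj by auto
        have "m \<in> S2"
          unfolding S2_def right_splits_def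
        proof (intro IntI CollectI bexI[of _ "\<lambda>i. y (- i)"] conjI allI impI)
          show "y (- (int m + 1)) \<noteq> x' (int m + 1)" using d by (simp add: x'_def)
          show "(\<lambda>i. y (- i)) \<in> X'" using y(1) by (auto simp: X'_def)
          show "m \<in> {N..<n}" using j k m by auto
          fix i assume "\<bar>i\<bar> \<le> int m"
          then show "y (- i) = x' i" using y(2)[of "-i"] by (auto simp: wj x'_def abs_le_iff)
        qed
        then show ?thesis using k m by auto
      qed
    qed
    then have "(\<Sum>j\<in>S. 1 / real (Suc j))
        \<le> (\<Sum>j\<in>(\<lambda>m. 2 * m + 1) ` S1 \<union> (\<lambda>m. 2 * m + 2) ` S2. 1 / real (Suc j))"
      by (intro sum_mono2) (auto simp: S1_def S2_def)
    also have "\<dots> = (\<Sum>j\<in>(\<lambda>m. 2 * m + 1) ` S1. 1 / real (Suc j))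
        + (\<Sum>j\<in>(\<lambda>m. 2 * m + 2) ` S2. 1 / real (Suc j))"
      by (rule sum.union_disjoint) (auto simp: S1_def S2_def, presburger)
    also have "(\<Sum>j\<in>(\<lambda>m. 2 * m + 1) ` S1. 1 / real (Suc j)) = (\<Sum>m\<in>S1. 1 / real (2 * m + 2))"
      by (subst sum.reindex) (auto simp: inj_on_def add_ac)
    also have "\<dots> \<le> (\<Sum>m\<in>S1. 1 / real m)"
      using N(3) by (intro sum_mono divide_left_mono) (auto simp: S1_def)
    also have "\<dots> \<le> B1 / real N"
      unfolding S1_def using B1[OF x N(1,3)] .
    also have "(\<Sum>j\<in>(\<lambda>m. 2 * m + 2) ` S2. 1 / real (Suc j)) = (\<Sum>m\<in>S2. 1 / real (2 * m + 3))"
      by (subst sum.reindex) (auto simp: inj_on_def add_ac)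
    also have "\<dots> \<le> (\<Sum>m\<in>S2. 1 / real m)"
      using N(3) by (intro sum_mono divide_left_mono) (auto simp: S2_def)
    also have "\<dots> \<le> B2 / real N"
      unfolding S2_def using B2[OF x' N(2,3)] .
    finally show "(\<Sum>j | 2 * N + 1 \<le> j \<and> j < n \<and> cell X (Suc j) x \<noteq> cell X j x. 1 / real (Suc j)) \<le> \<epsilon>"
      using small by (simp add: S_def)
  qed
qed

section \<open>Subshifts and cylinder sets\<close>

lemma translate_in_subshift:
  assumes "shift ` X = X" "x \<in> X"
  shows "(\<lambda>i. x (i + k)) \<in> X"
proof (induction k rule: int_induct[of _ 0])
  case base
  show ?case using assms(2) by simp
next
  case (step1 i)
  have "shift (\<lambda>j. x (j + i)) = (\<lambda>j. x (j + (i + 1)))"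
    by (simp add: shift_def add_ac)
  then show ?case using assms(1) step1(2) by (metis imageI)
next
  case (step2 i)
  then obtain z where z: "z \<in> X" "(\<lambda>j. x (j + i)) = shift z" using assms(1) by blast
  have "(\<lambda>j. x (j + (i - 1))) = z"
  proof
    fix j show "x (j + (i - 1)) = z j"
      using fun_cong[OF z(2), of "j - 1"] by (simp add: shift_def algebra_simps)
  qed
  then show ?case using z(1) by simp
qed

lemma topspace_subshift_top:
  assumes "subshift A X"
  shows "topspace (subshift_top A X) = X"
  using assms closedin_subset by (fastforce simp: subshift_def)

lemma compact_space_subshift_top:
  assumes "finite A" "subshift A X"
  shows "compact_space (subshift_top A X)"
proof -
  have "compact_space (full_shift A)"
    unfolding full_shift_def using assms(1)
    by (auto simp: compact_space_product_topology compact_space_discrete_topology)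
  then show ?thesis
    using assms(2) by (auto simp: subshift_def intro: closedin_compact_space compact_space_subtopology)
qed

lemma openin_prescribed_coordinates:
  assumes "subshift A X" "finite I"
  shows "openin (subshift_top A X) {z \<in> X. \<forall>i\<in>I. z (p i) = c i}"
  using assms(2)
proof (induction I rule: finite_induct)
  case empty
  show ?case using openin_topspace[of "subshift_top A X"] topspace_subshift_top[OF assms(1)] by simp
next
  case (insert a I)
  have cont: "continuous_map (subshift_top A X) (discrete_topology A) (\<lambda>z. z (p a))"
    unfolding full_shift_def
    by (intro continuous_map_from_subtopology continuous_map_product_projection) simp
  have "X \<subseteq> topspace (full_shift A)"
    using assms(1) closedin_subset by (auto simp: subshift_def)
  then have "\<And>z. z \<in> X \<Longrightarrow> z (p a) \<in> A"
    by (auto simp: full_shift_def PiE_def Pi_def)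
  then have "{z \<in> X. z (p a) = c a} = {z \<in> topspace (subshift_top A X). z (p a) \<in> {c a} \<inter> A}"
    unfolding topspace_subshift_top[OF assms(1)] by auto
  also have "openin (subshift_top A X) \<dots>"
    by (rule openin_continuous_map_preimage[OF cont]) auto
  finally have "openin (subshift_top A X) ({z \<in> X. z (p a) = c a} \<inter> {z \<in> X. \<forall>i\<in>I. z (p i) = c i})"
    using insert.IH by (rule openin_Int)
  also have "{z \<in> X. z (p a) = c a} \<inter> {z \<in> X. \<forall>i\<in>I. z (p i) = c i} =
      {z \<in> X. \<forall>i\<in>insert a I. z (p i) = c i}" by auto
  finally show ?case .
qed

lemma words_eq_factors:
  assumes "shift ` X = X"
  shows "words X n = factors X n"
proof -
  have eq: "map x [1..int n] = factor x 1 n" for x :: "int \<Rightarrow> 'a"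
    by (rule nth_equalityI) (auto simp: factor_def)
  have "factor x 1 n \<in> factors X n" if "x \<in> X" for x
    unfolding factors_def using translate_in_subshift[OF assms that, of 1]
    by (intro image_eqI[of _ _ "\<lambda>i. x (i + 1)"]) (simp_all add: factor_translate)
  moreover have "factor x 0 n \<in> words X n" if "x \<in> X" for x
    unfolding words_def eq using translate_in_subshift[OF assms that, of "-1"]
    by (intro CollectI exI[of _ "\<lambda>i. x (i + - 1)"]) (simp add: factor_translate del: add_uminus_conv_diff)
  ultimately show ?thesis by (auto simp: words_def factors_def eq)
qed

lemma take_drop_factor: "p + n \<le> m \<Longrightarrow> take n (drop p (factor x i m)) = factor x (i + int p) n"
  by (rule nth_equalityI) (auto simp: factor_def algebra_simps)

lemma factor_append: "factor x i m @ factor x (i + int m) n = factor x i (m + n)"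
  by (rule nth_equalityI) (auto simp: factor_def nth_append)

text \<open>By minimality the translates of the cylinder of a word cover \<open>X\<close>, and by compactness finitely many of them
  do.  The bound \<open>r\<close> is not quantitative; it only ensures that the word occurs on both sides of the origin, so
  that there are consecutive occurrences to which the condition on return words applies.\<close>

lemma bounded_occurrence:
  assumes "finite A" "minimal_subshift A X" "y \<in> X"
  shows "\<exists>r. \<forall>x\<in>X. \<exists>k. \<bar>k\<bar> \<le> (r::int) \<and> (\<forall>i<n. x (k + int i) = y (int i))"
proof -
  have X: "subshift A X" using assms(2) by (simp add: minimal_subshift_def)
  define V where "V k = {z \<in> X. \<forall>i\<in>{..<n}. z (k + int i) = y (int i)}" for k :: int
  have V: "openin (subshift_top A X) (V k)" for k
    unfolding V_def by (rule openin_prescribed_coordinates[OF X]) simp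
  have "X \<subseteq> \<Union> (range V)"
  proof
    fix x assume x: "x \<in> X"
    have "y \<in> subshift_top A X closure_of orbit x"
      using assms(2,3) x by (simp add: minimal_subshift_def)
    moreover have "y \<in> V 0" using assms(3) by (simp add: V_def)
    ultimately obtain z where "z \<in> orbit x" "z \<in> V 0"
      using V[of 0] by (auto simp: in_closure_of)
    then obtain k where "(\<lambda>i. x (i + k)) \<in> V 0" by (auto simp: orbit_def)
    then have "x \<in> V k" using x by (auto simp: V_def add_ac)
    then show "x \<in> \<Union> (range V)" by blast
  qed
  then obtain F where F: "finite F" "F \<subseteq> range V" "X \<subseteq> \<Union> F"
    using compact_space_subshift_top[OF assms(1) X] V
    unfolding compact_space_alt topspace_subshift_top[OF X] by (metis (no_types, lifting) imageE)
  then obtain I where I: "finite I" "F = V ` I" by (meson finite_subset_image)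
  define r where "r = Max (insert 0 (abs ` I))"
  have "\<exists>k. \<bar>k\<bar> \<le> r \<and> (\<forall>i<n. x (k + int i) = y (int i))" if x: "x \<in> X" for x
  proof -
    obtain k where k: "k \<in> I" "x \<in> V k" using x F(3) I(2) by blast
    have "\<bar>k\<bar> \<le> r" unfolding r_def using I(1) k(1) by (intro Max_ge) auto
    then show ?thesis using k(2) by (auto simp: V_def)
  qed
  then show ?thesis by blast
qed

text \<open>The last occurrence of the word at a negative position and the first at a nonnegative one
  are separated by a return word, so the latter lies less than \<open>K * n\<close> to the right of 0.\<close>

lemma linearly_recurrent_imp_words:
  assumes "finite A" "linearly_recurrent A X"
  obtains R where "linearly_recurrent_words X R"
proof -
  have min: "minimal_subshift A X" and X: "subshift A X"
    using assms(2) by (auto simp: linearly_recurrent_def minimal_subshift_def)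
  then have ne: "X \<noteq> {}" and sh: "shift ` X = X" by (auto simp: subshift_def)
  note translate = translate_in_subshift[OF sh]
  obtain K :: real where K: "\<And>n w r. 1 \<le> n \<Longrightarrow> w \<in> words X n \<Longrightarrow> right_return_word X w r \<Longrightarrow>
      real (length r) \<le> K * real (length w)"
    using assms(2) unfolding linearly_recurrent_def by blast
  define R where "R = nat \<lceil>K\<rceil>"
  have "linearly_recurrent_words X R"
  proof
    fix x y and n :: nat assume x: "x \<in> X" and y: "y \<in> X" and n: "0 < n"
    obtain r :: int where r: "\<And>x. x \<in> X \<Longrightarrow> \<exists>k. \<bar>k\<bar> \<le> r \<and> (\<forall>i<n. x (k + int i) = y (int i))"
      using bounded_occurrence[OF assms(1) min y] by metis
    define Occ where "Occ k \<longleftrightarrow> (\<forall>i<n. x (k + int i) = y (int i))" for k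
    have "\<exists>a. Occ (- 1 - int a)"
    proof -
      obtain k where k: "\<bar>k\<bar> \<le> r" "\<forall>i<n. x (k + int i + (- r - 1)) = y (int i)"
        using r[OF translate[OF x, of "- r - 1"]] by auto
      then have "Occ (- 1 - int (nat (r - k)))" by (auto simp: Occ_def algebra_simps)
      then show ?thesis by blast
    qed
    moreover have "\<exists>j. Occ (int j)"
    proof -
      obtain k where k: "\<bar>k\<bar> \<le> r" "\<forall>i<n. x (k + int i + r) = y (int i)"
        using r[OF translate[OF x, of r]] by auto
      then have "Occ (int (nat (k + r)))" by (auto simp: Occ_def algebra_simps)
      then show ?thesis by blast
    qed
    ultimately obtain a j where a: "Occ (- 1 - int a)" "\<And>b. b < a \<Longrightarrow> \<not> Occ (- 1 - int b)"
      and j: "Occ (int j)" "\<And>b. b < j \<Longrightarrow> \<not> Occ (int b)"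
      using exists_least_iff[of "\<lambda>a. Occ (- 1 - int a)"] exists_least_iff[of "\<lambda>a. Occ (int a)"] by metis
    define w where "w = factor y 0 n"
    define s where "s = - 1 - int a"
    define m where "m = Suc (a + j)"
    define v where "v = factor x s m"
    have Occ_w: "factor x k n = w \<longleftrightarrow> Occ k" for k
      by (auto simp: w_def factor_eq_iff Occ_def)
    have sm: "s + int m = int j" by (simp add: s_def m_def)
    have vw: "v @ w = factor x s (m + n)"
      using j(1) Occ_w[of "int j"] factor_append[of x s m n] by (simp add: v_def sm)
    have "occurrences w (v @ w) = {0, m}"
    proof (rule set_eqI)
      fix p
      have "p \<in> occurrences w (v @ w) \<longleftrightarrow> p \<le> m \<and> Occ (s + int p)"
        unfolding occurrences_def vw by (auto simp: w_def take_drop_factor Occ_w[unfolded w_def])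
      also have "\<dots> \<longleftrightarrow> p = 0 \<or> p = m"
      proof
        assume p: "p \<le> m \<and> Occ (s + int p)"
        show "p = 0 \<or> p = m"
        proof (cases "p \<le> a")
          case True
          then have eq: "s + int p = - 1 - int (a - p)" by (simp add: s_def of_nat_diff)
          have "\<not> Occ (s + int p)" if "0 < p"
            unfolding eq using a(2)[of "a - p"] that True by simp
          then show ?thesis using p by auto
        next
          case False
          then have eq: "s + int p = int (p - Suc a)" by (simp add: s_def of_nat_diff)
          have "\<not> Occ (s + int p)" if "p < m"
            unfolding eq using j(2)[of "p - Suc a"] that False by (simp add: m_def)
          then show ?thesis using p by force
        qed
      qed (use a(1) j(1) sm in \<open>auto simp: s_def\<close>)
      finally show "p \<in> occurrences w (v @ w) \<longleftrightarrow> p \<in> {0, m}" by simp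
    qed
    then have "card (occurrences w (v @ w)) = 2" by (simp add: m_def)
    moreover have "prefix w (v @ w)"
    proof -
      have "take n (v @ w) = w"
        unfolding vw using take_drop_factor[of 0 n "m + n" x s] Occ_w a(1) by (simp add: s_def)
      then show ?thesis by (metis take_is_prefix)
    qed
    moreover have "admissible X (v @ w)"
      unfolding admissible_def words_eq_factors[OF sh]
    proof (intro exI[of _ "m + n"] conjI)
      show "v @ w \<in> factors X (m + n)"
        unfolding vw factors_def using translate[OF x, of s] factor_translate[of x s 0 "m + n"]
        by (auto intro: image_eqI[of _ _ "\<lambda>k. x (k + s)"])
    qed (simp add: m_def)
    ultimately have "right_return_word X w v" by (simp add: right_return_word_def)
    moreover have "w \<in> words X n" unfolding words_eq_factors[OF sh] using y by (simp add: w_def factors_def)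
    ultimately have "real m \<le> K * real n"
      using K[of n w v] n by (simp add: v_def w_def)
    also have "\<dots> \<le> real R * real n" by (intro mult_right_mono) (auto simp: R_def real_nat_ceiling_ge)
    finally have "m \<le> R * n" by (simp flip: of_nat_mult)
    then have "j < R * n" by (simp add: m_def)
    then show "\<exists>k<R * n. \<forall>i<n. x (int k + int i) = y (int i)"
      using j(1) by (auto simp: Occ_def)
  qed (use ne translate in auto)
  then show thesis by (rule that)
qed

lemma window_eq: "window n = (\<lambda>i. 1 - int ((n + 1) div 2) + int i) ` {..<n}"
proof -
  have "n = (n + 1) div 2 + n div 2" by presburger
  then have *: "int n = int ((n + 1) div 2) + int (n div 2)" by linarith
  show ?thesis
  proof (intro equalityI subsetI)
    fix k assume "k \<in> window n"
    then have "nat (k - (1 - int ((n + 1) div 2))) < n"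
        "k = 1 - int ((n + 1) div 2) + int (nat (k - (1 - int ((n + 1) div 2))))"
      using * by (auto simp: window_def)
    then show "k \<in> (\<lambda>i. 1 - int ((n + 1) div 2) + int i) ` {..<n}" by blast
  qed (use * in \<open>auto simp: window_def\<close>)
qed

definition central_word :: "(int \<Rightarrow> 'a) \<Rightarrow> nat \<Rightarrow> 'a list" where
  "central_word x n = factor x (1 - int ((n + 1) div 2)) n"

lemma cell_eq_central_word: "cell X n x = {y \<in> X. central_word y n = central_word x n}"
  by (auto simp: cell_def window_eq central_word_def factor_eq_iff)

lemma central_word_in_words:
  assumes "shift ` X = X" "x \<in> X"
  shows "central_word x n \<in> words X n"
  unfolding words_eq_factors[OF assms(1)] factors_def central_word_def
  using translate_in_subshift[OF assms, of "1 - int ((n + 1) div 2)"]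
  by (intro image_eqI[of _ _ "\<lambda>i. x (i + (1 - int ((n + 1) div 2)))"]) (simp_all add: factor_translate)

lemma cylinder_eq:
  assumes "length w = n"
  shows "cylinder X w = {x \<in> X. central_word x n = w}"
proof -
  have "map x [1 - int ((n + 1) div 2)..int (n div 2)] = central_word x n" for x :: "int \<Rightarrow> 'a"
  proof (rule nth_equalityI)
    have "n = (n + 1) div 2 + n div 2" by presburger
    then have *: "int n = int ((n + 1) div 2) + int (n div 2)" by linarith
    then show len: "length (map x [1 - int ((n + 1) div 2)..int (n div 2)]) = length (central_word x n)"
      by (simp add: central_word_def)
    fix i assume "i < length (map x [1 - int ((n + 1) div 2)..int (n div 2)])"
    then have "i < n" using * by simp
    then show "map x [1 - int ((n + 1) div 2)..int (n div 2)] ! i = central_word x n ! i"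
      using * by (simp add: central_word_def factor_def)
  qed
  moreover have "odd n \<Longrightarrow> 1 - int ((n + 1) div 2) = - int (n div 2)"
    "even n \<Longrightarrow> 1 - int ((n + 1) div 2) = 1 - int (n div 2)" by presburger+
  ultimately show ?thesis
    using assms by (cases "odd n") (simp_all add: cylinder_def Let_def)
qed

text \<open>A description of \<open>C\<^sub>n\<close> without words: functions supported in \<open>X\<close> and constant on cells.  It includes
  \<open>n = 0\<close>, where the only cell is \<open>X\<close>.\<close>

lemma cyl_space_iff:
  assumes sh: "shift ` X = X" and fin: "finite (words X n)"
  shows "f \<in> cyl_space X (int n) \<longleftrightarrow>
    (\<forall>x. x \<notin> X \<longrightarrow> f x = 0) \<and> (\<forall>x\<in>X. \<forall>y\<in>cell X n x. f y = f x)"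
    (is "?L \<longleftrightarrow> ?R")
proof (cases "n = 0")
  case True
  have "?R \<longleftrightarrow> (\<exists>c. f = (\<lambda>x. c * indicator X x))"
  proof
    assume R: ?R
    show "\<exists>c. f = (\<lambda>x. c * indicator X x)"
    proof (cases "X = {}")
      case False
      then obtain z where "z \<in> X" by blast
      have "f x = f z * indicator X x" for x
      proof (cases "x \<in> X")
        case x: True
        then have "x \<in> cell X n z" using True by (simp add: cell_def window_def)
        then have "f x = f z" using R \<open>z \<in> X\<close> by blast
        then show ?thesis using x by simp
      qed (use R in simp)
      then have "f = (\<lambda>x. f z * indicator X x)" by blast
      then show ?thesis by blast
    qed (use R in \<open>auto simp: fun_eq_iff\<close>)
  qed (auto simp: cell_def indicator_def)
  then show ?thesis using True by (auto simp: cyl_space_def)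
next
  case False
  have sum_at: "(\<Sum>w\<in>words X n. c w * indicator (cylinder X w) x) =
      (if x \<in> X then c (central_word x n) else (0::complex))" for c x
  proof -
    have "(\<Sum>w\<in>words X n. c w * indicator (cylinder X w) x) =
        (\<Sum>w\<in>words X n. if x \<in> X \<and> w = central_word x n then c w else 0)"
    proof (rule sum.cong)
      fix w assume "w \<in> words X n"
      then have "length w = n" by (auto simp: words_def)
      then show "c w * indicator (cylinder X w) x = (if x \<in> X \<and> w = central_word x n then c w else 0)"
        by (auto simp: cylinder_eq indicator_def)
    qed simp
    also have "\<dots> = (if x \<in> X then c (central_word x n) else 0)"
      using fin central_word_in_words[OF sh] by (cases "x \<in> X") (auto simp: sum.delta)
    finally show ?thesis .
  qed
  have space: "cyl_space X (int n) = {(\<lambda>x. if x \<in> X then c (central_word x n) else 0) | c. True}"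
    using False by (simp add: cyl_space_def sum_at)
  show ?thesis
  proof
    assume ?L
    then show ?R by (auto simp: space cell_eq_central_word)
  next
    assume R: ?R
    define c where "c w = f (SOME x. x \<in> X \<and> central_word x n = w)" for w
    have "c (central_word x n) = f x" if x: "x \<in> X" for x
    proof -
      have "(SOME y. y \<in> X \<and> central_word y n = central_word x n) \<in> cell X n x"
        unfolding cell_eq_central_word using x someI[of "\<lambda>y. y \<in> X \<and> central_word y n = central_word x n" x]
        by auto
      then show ?thesis using R x by (auto simp: c_def)
    qed
    then have "f = (\<lambda>x. if x \<in> X then c (central_word x n) else 0)" using R by auto
    then show ?L unfolding space by blast
  qed
qed

lemma finite_cells:
  assumes "shift ` X = X" "finite (words X n)"
  shows "finite (cell X n ` X)"
proof -
  have "cell X n ` X \<subseteq> (\<lambda>w. {y \<in> X. central_word y n = w}) ` words X n"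
    using central_word_in_words[OF assms(1)] by (auto simp: cell_eq_central_word)
  then show ?thesis using assms(2) finite_surj by blast
qed

lemma openin_cell: "subshift A X \<Longrightarrow> openin (subshift_top A X) (cell X n x)"
  using openin_prescribed_coordinates[of A X "window n" id x] by (simp add: cell_def window_def)

text \<open>By recurrence, \<open>R * n\<close> preimages of the cell under powers of the shift cover \<open>X\<close>, and they all have the same
  measure.\<close>

lemma measure_cell_ge:
  assumes "linearly_recurrent_words X R" "subshift A X" "invariant_prob_measure A X M"
    and x: "x \<in> X" and n: "0 < n"
  shows "1 / (real R * real n) \<le> measure M (cell X n x)"
proof -
  interpret linearly_recurrent_words X R by fact
  interpret prob_space M using assms(3) by (simp add: invariant_prob_measure_def)
  have inv: "\<And>B. B \<in> sets M \<Longrightarrow> emeasure M (shift -` B \<inter> X) = emeasure M B"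
    and spM: "space M = X"
    and op: "\<And>U. openin (subshift_top A X) U \<Longrightarrow> U \<in> sets M"
    using assms(3) by (auto simp: invariant_prob_measure_def)
  define V where "V k = {z \<in> X. \<forall>i\<in>window n. z (i + int k) = x i}" for k
  have V: "V k \<in> sets M" for k
    unfolding V_def by (intro op openin_prescribed_coordinates assms) (simp add: window_def)
  have "emeasure M (V k) = emeasure M (cell X n x)" for k
  proof (induction k)
    case 0
    show ?case by (simp add: V_def cell_def)
  next
    case (Suc k)
    have "shift z \<in> X" if "z \<in> X" for z using assms(2) that by (auto simp: subshift_def)
    then have "V (Suc k) = shift -` V k \<inter> X"
      by (auto simp: V_def shift_def add_ac)
    then show ?case using inv[OF V[of k]] Suc by simp
  qed
  then have VM: "measure M (V k) = measure M (cell X n x)" for k by (simp add: measure_def)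
  have "X \<subseteq> (\<Union>k<R * n. V k)"
  proof
    fix z assume z: "z \<in> X"
    let ?l = "1 - int ((n + 1) div 2)"
    obtain k where "k < R * n" "\<forall>i<n. z (int k + int i + ?l) = x (int i + ?l)"
      using recurrence[OF translate[OF z, of ?l] translate[OF x, of ?l] n] by auto
    then show "z \<in> (\<Union>k<R * n. V k)"
      using z by (auto simp: V_def window_eq add_ac intro!: bexI[of _ k])
  qed
  then have "1 \<le> measure M (\<Union>k<R * n. V k)"
    using V finite_measure_mono[of X "\<Union>k<R * n. V k"] prob_space spM by auto
  also have "\<dots> \<le> (\<Sum>k<R * n. measure M (V k))"
    using V by (intro finite_measure_subadditive_finite) auto
  also have "\<dots> = real R * real n * measure M (cell X n x)" by (simp add: VM)
  finally show ?thesis using R_pos n by (simp add: field_simps)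
qed

text \<open>Uniform continuity: the cells form a basis of the topology of the compact space \<open>X\<close>.\<close>

lemma uniform_approximation_by_cells:
  assumes "finite A" "subshift A X"
    and g: "continuous_map (subshift_top A X) euclidean (g :: _ \<Rightarrow> complex)" and "0 < (\<epsilon>::real)"
  shows "\<exists>n. \<forall>x\<in>X. \<forall>y\<in>cell X n x. cmod (g y - g x) < \<epsilon>"
proof -
  let ?T = "subshift_top A X"
  note ts = topspace_subshift_top[OF assms(2)]
  define \<U> where "\<U> = {cell X n x | n x. x \<in> X \<and> (\<forall>y\<in>cell X n x. cmod (g y - g x) < \<epsilon> / 2)}"
  have "X \<subseteq> \<Union> \<U>"
  proof
    fix x assume x: "x \<in> X"
    define W where "W = {y \<in> topspace ?T. g y \<in> ball (g x) (\<epsilon> / 2)}"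
    have "openin ?T W" unfolding W_def by (rule openin_continuous_map_preimage[OF g]) simp
    then obtain S where S: "openin (full_shift A) S" "W = S \<inter> X" by (auto simp: openin_subtopology)
    have "x \<in> W" using x assms(4) unfolding W_def ts by simp
    then have "x \<in> S" using S by blast
    then obtain B where B: "finite {i. B i \<noteq> topspace (discrete_topology A)}" "x \<in> PiE UNIV B" "PiE UNIV B \<subseteq> S"
      using S(1) unfolding full_shift_def openin_product_topology_alt by (auto; metis)
    \<comment> \<open>A length whose window contains every restricted coordinate.\<close>
    define n where "n = (\<Sum>i\<in>{i. B i \<noteq> A}. 2 * nat \<bar>i\<bar> + 2)"
    have "cell X n x \<subseteq> S"
    proof
      fix y assume y: "y \<in> cell X n x"
      have "y i \<in> B i" for i
      proof (cases "B i = A")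
        case True
        have "y \<in> topspace (full_shift A)"
          using y assms(2) closedin_subset by (fastforce simp: subshift_def cell_def)
        then show ?thesis using True by (auto simp: full_shift_def PiE_def Pi_def)
      next
        case False
        have "2 * nat \<bar>i\<bar> + 2 \<le> n"
          unfolding n_def using False B(1) member_le_sum[of i "{i. B i \<noteq> A}" "\<lambda>i. 2 * nat \<bar>i\<bar> + 2"] by simp
        then have "i \<in> window n" by (auto simp: window_def)
        then have "y i = x i" using y by (simp add: cell_def)
        then show ?thesis using B(2) by auto
      qed
      then show "y \<in> S" using B(3) by auto
    qed
    then have "cell X n x \<subseteq> W" using S(2) by (auto simp: cell_def)
    then have "cell X n x \<in> \<U>" using x by (fastforce simp: \<U>_def W_def dist_norm norm_minus_commute)
    moreover have "x \<in> cell X n x" using x by (simp add: cell_def)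
    ultimately show "x \<in> \<Union> \<U>" by blast
  qed
  then obtain \<F> where \<F>: "finite \<F>" "\<F> \<subseteq> \<U>" "X \<subseteq> \<Union> \<F>"
    using compact_space_subshift_top[OF assms(1,2)] openin_cell[OF assms(2)]
    unfolding compact_space_alt ts \<U>_def by (smt (verit, del_insts) mem_Collect_eq)
  have "\<forall>U\<in>\<F>. \<exists>n x. U = cell X n x \<and> (\<forall>y\<in>U. cmod (g y - g x) < \<epsilon> / 2)"
  proof
    fix U assume "U \<in> \<F>"
    then have "U \<in> \<U>" using \<F>(2) by blast
    then show "\<exists>n x. U = cell X n x \<and> (\<forall>y\<in>U. cmod (g y - g x) < \<epsilon> / 2)"
      unfolding \<U>_def by blast
  qed
  then obtain N c where Nc: "\<And>U. U \<in> \<F> \<Longrightarrow> U = cell X (N U) (c U) \<and> (\<forall>y\<in>U. cmod (g y - g (c U)) < \<epsilon> / 2)"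
    by metis
  define n where "n = (\<Sum>U\<in>\<F>. N U)"
  have "cmod (g y - g x) < \<epsilon>" if x: "x \<in> X" and y: "y \<in> cell X n x" for x y
  proof -
    obtain U where U: "U \<in> \<F>" "x \<in> U" using x \<F>(3) by blast
    have "N U \<le> n" unfolding n_def using U \<F>(1) by (intro member_le_sum) auto
    then have "y \<in> cell X (N U) x" using y cell_mono by blast
    moreover have eq: "U = cell X (N U) (c U)" using Nc[OF U(1)] by blast
    then have "x \<in> cell X (N U) (c U)" using U(2) by blast
    ultimately have "y \<in> cell X (N U) (c U)" by (simp add: cell_def)
    then have "y \<in> U" using eq by blast
    then have "cmod (g y - g (c U)) < \<epsilon> / 2" "cmod (g x - g (c U)) < \<epsilon> / 2"
      using Nc[OF U(1)] U(2) by auto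
    then show ?thesis using norm_triangle_ineq4[of "g y - g (c U)" "g x - g (c U)"] by simp
  qed
  then show ?thesis by blast
qed

section \<open>The commutator and conditional expectations\<close>

lemma cell_eqI: "y \<in> cell X n x \<Longrightarrow> cell X n y = cell X n x"
  by (auto simp: cell_def)

lemma cell_refl: "x \<in> X \<Longrightarrow> x \<in> cell X n x"
  by (simp add: cell_def)

lemma cell_0: "cell X 0 x = X"
  by (simp add: cell_def window_def)

text \<open>What the operator theory needs to know about the subshift: there are finitely many cells of each length, and
  none of them is too small.\<close>

locale cell_measure = prob_space M for M :: "(int \<Rightarrow> 'a) measure" +
  fixes X :: "(int \<Rightarrow> 'a) set" and R :: nat
  assumes space_eq: "space M = X"
    and shift_image: "shift ` X = X"
    and finite_words: "finite (words X n)"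
    and cell_measurable: "cell X n x \<in> sets M"
    and ratio_pos: "0 < R"
    and cell_large: "x \<in> X \<Longrightarrow> 0 < n \<Longrightarrow> 1 / (real R * real n) \<le> measure M (cell X n x)"
begin

abbreviation C :: "nat \<Rightarrow> ((int \<Rightarrow> 'a) \<Rightarrow> complex) set" where
  "C n \<equiv> cyl_space X (int n)"

lemmas C_iff = cyl_space_iff[OF shift_image finite_words]

lemma C_vanish: "f \<in> C n \<Longrightarrow> x \<notin> X \<Longrightarrow> f x = 0"
  by (simp add: C_iff)

lemma C_const: "f \<in> C n \<Longrightarrow> x \<in> X \<Longrightarrow> y \<in> cell X n x \<Longrightarrow> f y = f x"
  by (simp add: C_iff)

lemma C_mono: "m \<le> n \<Longrightarrow> f \<in> C m \<Longrightarrow> f \<in> C n"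
  using cell_mono[of m n X] unfolding C_iff by blast

lemma C_I:
  assumes "\<And>x. x \<notin> X \<Longrightarrow> f x = 0" "\<And>x y. x \<in> X \<Longrightarrow> y \<in> cell X n x \<Longrightarrow> f y = f x"
  shows "f \<in> C n"
  using assms unfolding C_iff by blast

lemma C_combine:
  assumes "f \<in> C n" "g \<in> C n" "H 0 0 = 0"
  shows "(\<lambda>x. H (f x) (g x)) \<in> C n"
proof (rule C_I)
  fix x assume "x \<notin> X"
  then show "H (f x) (g x) = 0" using C_vanish[OF assms(1)] C_vanish[OF assms(2)] assms(3) by simp
next
  fix x y assume "x \<in> X" "y \<in> cell X n x"
  then show "H (f y) (g y) = H (f x) (g x)" by (simp only: C_const[OF assms(1)] C_const[OF assms(2)])
qed

lemma C_zero: "(\<lambda>x. 0) \<in> C n"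
  by (rule C_I) simp_all

lemma C_indicator_space: "indicator X \<in> C n"
  by (rule C_I) (simp_all add: cell_def)

lemma C_add: "f \<in> C n \<Longrightarrow> g \<in> C n \<Longrightarrow> (\<lambda>x. f x + g x) \<in> C n"
  and C_diff: "f \<in> C n \<Longrightarrow> g \<in> C n \<Longrightarrow> (\<lambda>x. f x - g x) \<in> C n"
  and C_mult: "f \<in> C n \<Longrightarrow> g \<in> C n \<Longrightarrow> (\<lambda>x. f x * g x) \<in> C n"
  by (rule C_combine; simp)+

lemma C_scale: "f \<in> C n \<Longrightarrow> (\<lambda>x. c * f x) \<in> C n"
  and C_cnj: "f \<in> C n \<Longrightarrow> (\<lambda>x. cnj (f x)) \<in> C n"
  using C_combine[of f n f "\<lambda>a b. c * a"] C_combine[of f n f "\<lambda>a b. cnj a"] by simp_all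

lemma C_sum: "(\<And>i. i \<in> I \<Longrightarrow> f i \<in> C n) \<Longrightarrow> (\<lambda>x. \<Sum>i\<in>I. f i x) \<in> C n"
  by (induction I rule: infinite_finite_induct) (auto intro: C_zero C_add)

lemma C_indicator_cell: "indicator (cell X n x) \<in> C n"
  unfolding C_iff by (auto simp: cell_def indicator_def)

lemma finite_partition: "finite (cell X n ` X)"
  by (rule finite_cells[OF shift_image finite_words])

text \<open>A chosen point of each cell, at which functions in \<open>C\<^sub>n\<close> are evaluated to obtain their coefficients.\<close>

definition rep :: "(int \<Rightarrow> 'a) set \<Rightarrow> int \<Rightarrow> 'a" where
  "rep U = (SOME x. x \<in> U)"

lemma rep_in: "x \<in> X \<Longrightarrow> rep (cell X n x) \<in> cell X n x"
  unfolding rep_def by (rule someI[of _ x]) (rule cell_refl)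

lemma C_expand:
  assumes "f \<in> C n"
  shows "f x = (\<Sum>U\<in>cell X n ` X. f (rep U) * indicator U x)"
proof (cases "x \<in> X")
  case True
  have "(\<Sum>U\<in>cell X n ` X. f (rep U) * indicator U x)
      = (\<Sum>U\<in>cell X n ` X. if U = cell X n x then f x else 0)"
  proof (rule sum.cong)
    fix U assume "U \<in> cell X n ` X"
    then obtain y where y: "y \<in> X" "U = cell X n y" by blast
    have "x \<in> U \<longleftrightarrow> U = cell X n x" using y True cell_eqI cell_refl by blast
    moreover have "f (rep (cell X n x)) = f x"
      using C_const[OF assms True rep_in[OF True]] .
    ultimately show "f (rep U) * indicator U x = (if U = cell X n x then f x else 0)"
      by (auto simp: indicator_def)
  qed simp
  then show ?thesis using True finite_partition by simp
next
  case False
  then show ?thesis using C_vanish[OF assms False] by (auto simp: cell_def indicator_def intro!: sum.neutral)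
qed

lemma C_bounded:
  assumes "f \<in> C n"
  obtains b where "0 \<le> b" "\<And>x. cmod (f x) \<le> b"
proof
  show "0 \<le> (\<Sum>U\<in>cell X n ` X. cmod (f (rep U)))" by (intro sum_nonneg) simp
  show "cmod (f x) \<le> (\<Sum>U\<in>cell X n ` X. cmod (f (rep U)))" for x
    by (subst C_expand[OF assms]) (intro order_trans[OF norm_sum] sum_mono, auto simp: norm_mult indicator_def)
qed

lemma C_measurable: "f \<in> C n \<Longrightarrow> f \<in> borel_measurable M"
proof -
  assume f: "f \<in> C n"
  have "(\<lambda>x. \<Sum>U\<in>cell X n ` X. f (rep U) * indicator U x) \<in> borel_measurable M"
    using cell_measurable by (intro borel_measurable_sum borel_measurable_times) auto
  then show ?thesis using C_expand[OF f] by (metis (no_types, lifting) ext)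
qed

lemma bounded_L2:
  assumes "f \<in> borel_measurable M" "\<And>x. cmod (f x) \<le> b"
  shows "f \<in> L2 M"
proof -
  have "integrable M (\<lambda>x. (cmod (f x))\<^sup>2)"
  proof (rule integrable_const_bound[of _ "b\<^sup>2"])
    show "AE x in M. norm ((cmod (f x))\<^sup>2) \<le> b\<^sup>2"
      using assms(2) by (auto intro!: power_mono)
  qed (use assms(1) in measurable)
  then show ?thesis using assms(1) by (simp add: L2_def)
qed

lemma C_L2: "f \<in> C n \<Longrightarrow> f \<in> L2 M"
  by (metis C_bounded C_measurable bounded_L2)

lemma L2_measurable: "f \<in> L2 M \<Longrightarrow> f \<in> borel_measurable M"
  and L2_square_integrable: "f \<in> L2 M \<Longrightarrow> integrable M (\<lambda>x. (cmod (f x))\<^sup>2)"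
  by (simp_all add: L2_def)

lemma L2_cmod_integrable: "f \<in> L2 M \<Longrightarrow> integrable M (\<lambda>x. cmod (f x))"
proof (rule Bochner_Integration.integrable_bound[of M "\<lambda>x. 1 + (cmod (f x))\<^sup>2"])
  assume f: "f \<in> L2 M"
  show "integrable M (\<lambda>x. 1 + (cmod (f x))\<^sup>2)" using L2_square_integrable[OF f] by simp
  show "(\<lambda>x. cmod (f x)) \<in> borel_measurable M" using L2_measurable[OF f] by simp
  have "t \<le> 1 + t\<^sup>2" if "0 \<le> t" for t :: real
    using that self_le_power[of t 2] by (cases "1 \<le> t") (auto simp: add_increasing2)
  then show "AE x in M. norm (cmod (f x)) \<le> norm (1 + (cmod (f x))\<^sup>2)" by simp
qed

lemma L2_integrable: "f \<in> L2 M \<Longrightarrow> integrable M f"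
  using L2_cmod_integrable L2_measurable integrable_norm_iff by blast

lemma L2_bounded_mult:
  assumes "f \<in> L2 M" "g \<in> borel_measurable M" "\<And>x. cmod (g x) \<le> b"
  shows "(\<lambda>x. g x * f x) \<in> L2 M"
proof -
  have "integrable M (\<lambda>x. (cmod (g x * f x))\<^sup>2)"
  proof (rule Bochner_Integration.integrable_bound[of M "\<lambda>x. b\<^sup>2 * (cmod (f x))\<^sup>2"])
    show "integrable M (\<lambda>x. b\<^sup>2 * (cmod (f x))\<^sup>2)" using L2_square_integrable[OF assms(1)] by simp
    show "(\<lambda>x. (cmod (g x * f x))\<^sup>2) \<in> borel_measurable M"
      using assms(2) L2_measurable[OF assms(1)] by simp
    show "AE x in M. norm ((cmod (g x * f x))\<^sup>2) \<le> norm (b\<^sup>2 * (cmod (f x))\<^sup>2)"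
      using assms(3) by (auto simp: norm_mult power_mult_distrib intro!: mult_right_mono power_mono)
  qed
  then show ?thesis using assms(2) L2_measurable[OF assms(1)] by (simp add: L2_def)
qed

lemma L2_C_mult: "f \<in> C n \<Longrightarrow> g \<in> L2 M \<Longrightarrow> (\<lambda>x. f x * g x) \<in> L2 M"
  by (metis C_bounded C_measurable L2_bounded_mult)

text \<open>A crude substitute for Minkowski's inequality: the constant 2 does no harm below, where norms only have to be
  bounded or to tend to 0.\<close>

lemma cmod_add_square: "(cmod (a + b))\<^sup>2 \<le> 2 * (cmod a)\<^sup>2 + 2 * (cmod b)\<^sup>2"
proof -
  have "(cmod (a + b))\<^sup>2 \<le> (cmod a + cmod b)\<^sup>2"
    by (intro power_mono norm_triangle_ineq) simp
  also have "\<dots> \<le> 2 * (cmod a)\<^sup>2 + 2 * (cmod b)\<^sup>2"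
    using sum_squares_bound[of "cmod a" "cmod b"] by (simp add: power2_sum)
  finally show ?thesis .
qed

lemma L2_add:
  assumes "f \<in> L2 M" "g \<in> L2 M"
  shows "(\<lambda>x. f x + g x) \<in> L2 M"
    and "(LINT x|M. (cmod (f x + g x))\<^sup>2) \<le>
      2 * (LINT x|M. (cmod (f x))\<^sup>2) + 2 * (LINT x|M. (cmod (g x))\<^sup>2)"
proof -
  note int = L2_square_integrable[OF assms(1)] L2_square_integrable[OF assms(2)]
  have int': "integrable M (\<lambda>x. 2 * (cmod (f x))\<^sup>2 + 2 * (cmod (g x))\<^sup>2)" using int by simp
  have "integrable M (\<lambda>x. (cmod (f x + g x))\<^sup>2)"
    using cmod_add_square L2_measurable[OF assms(1)] L2_measurable[OF assms(2)]
    by (intro Bochner_Integration.integrable_bound[OF int']) auto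
  then show "(\<lambda>x. f x + g x) \<in> L2 M"
    using L2_measurable[OF assms(1)] L2_measurable[OF assms(2)] by (simp add: L2_def)
  have "(LINT x|M. (cmod (f x + g x))\<^sup>2) \<le> (LINT x|M. 2 * (cmod (f x))\<^sup>2 + 2 * (cmod (g x))\<^sup>2)"
    using \<open>integrable M (\<lambda>x. (cmod (f x + g x))\<^sup>2)\<close> int' cmod_add_square by (intro integral_mono)
  also have "\<dots> = 2 * (LINT x|M. (cmod (f x))\<^sup>2) + 2 * (LINT x|M. (cmod (g x))\<^sup>2)"
    using int by simp
  finally show "(LINT x|M. (cmod (f x + g x))\<^sup>2) \<le>
      2 * (LINT x|M. (cmod (f x))\<^sup>2) + 2 * (LINT x|M. (cmod (g x))\<^sup>2)" .
qed

lemma L2_minus: "f \<in> L2 M \<Longrightarrow> (\<lambda>x. - f x) \<in> L2 M"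
  by (simp add: L2_def)

lemma L2_diff:
  assumes "f \<in> L2 M" "g \<in> L2 M"
  shows "(\<lambda>x. f x - g x) \<in> L2 M"
    and "(LINT x|M. (cmod (f x - g x))\<^sup>2) \<le>
      2 * (LINT x|M. (cmod (f x))\<^sup>2) + 2 * (LINT x|M. (cmod (g x))\<^sup>2)"
  using L2_add[OF assms(1) L2_minus[OF assms(2)]] by simp_all

lemma l2_norm_square: "(l2_norm M f)\<^sup>2 = (LINT x|M. (cmod (f x))\<^sup>2)"
  by (simp add: l2_norm_def)

lemma integral_cmod_le_l2_norm:
  assumes "f \<in> L2 M"
  shows "(LINT x|M. cmod (f x)) \<le> l2_norm M f"
proof -
  have "0 \<le> variance (\<lambda>x. cmod (f x))" by (rule variance_positive)
  then have "(LINT x|M. cmod (f x))\<^sup>2 \<le> (LINT x|M. (cmod (f x))\<^sup>2)"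
    using variance_eq[OF L2_cmod_integrable L2_square_integrable, OF assms assms] by simp
  then show ?thesis unfolding l2_norm_def by (rule real_le_rsqrt)
qed

lemma inverse_measure_cell_le:
  assumes "x \<in> X" "0 < n"
  shows "0 < measure M (cell X n x)" "1 / measure M (cell X n x) \<le> real R * real n"
proof -
  have "0 < 1 / (real R * real n)" using ratio_pos assms(2) by simp
  then show pos: "0 < measure M (cell X n x)" using cell_large[OF assms] by linarith
  show "1 / measure M (cell X n x) \<le> real R * real n"
    using cell_large[OF assms] ratio_pos assms(2) pos by (simp add: field_simps)
qed

lemma measure_cell:
  assumes "x \<in> X"
  shows "0 < measure M (cell X n x)" "1 / measure M (cell X n x) \<le> real R * real n + 1"
  using inverse_measure_cell_le[OF assms, of n] prob_space space_eq
  by (cases "n = 0"; simp add: cell_0)+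

text \<open>The conditional expectation onto \<open>C\<^sub>n\<close>; on \<open>L\<^sup>2\<close> it is the orthogonal projection.\<close>

definition avg :: "nat \<Rightarrow> ((int \<Rightarrow> 'a) \<Rightarrow> complex) \<Rightarrow> (int \<Rightarrow> 'a) \<Rightarrow> complex" where
  "avg n g x = (if x \<in> X
     then (LINT y|M. g y * indicator (cell X n x) y) / of_real (measure M (cell X n x)) else 0)"

lemma avg_in_C: "avg n g \<in> C n"
  unfolding C_iff by (auto simp: avg_def cell_eqI) (auto simp: cell_def)

lemma integrable_mult_C:
  assumes "integrable M g" "h \<in> C n"
  shows "integrable M (\<lambda>x. g x * h x)"
proof -
  obtain b where b: "0 \<le> b" "\<And>x. cmod (h x) \<le> b" using C_bounded[OF assms(2)] by blast
  show ?thesis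
  proof (rule Bochner_Integration.integrable_bound[of M "\<lambda>x. b * cmod (g x)"])
    show "integrable M (\<lambda>x. b * cmod (g x))" using assms(1) by simp
    show "(\<lambda>x. g x * h x) \<in> borel_measurable M"
      using C_measurable[OF assms(2)] assms(1) by simp
    show "AE x in M. norm (g x * h x) \<le> norm (b * cmod (g x))"
    proof (rule AE_I2)
      fix x show "norm (g x * h x) \<le> norm (b * cmod (g x))"
        using b(1) mult_left_mono[OF b(2)[of x] norm_ge_zero[of "g x"]] by (simp add: norm_mult mult.commute)
    qed
  qed
qed

lemma integral_C_cell:
  assumes "h \<in> C n" "x \<in> X"
  shows "(LINT y|M. h y * indicator (cell X n x) y) = h x * of_real (measure M (cell X n x))"
proof -
  have "(LINT y|M. h y * indicator (cell X n x) y) = (LINT y|M. indicator (cell X n x) y *\<^sub>R h x)"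
    using C_const[OF assms] by (intro Bochner_Integration.integral_cong) (auto simp: indicator_def)
  also have "\<dots> = measure M (cell X n x) *\<^sub>R h x"
    by (rule has_bochner_integral_integral_eq[OF has_bochner_integral_indicator])
      (simp_all add: cell_measurable emeasure_eq_measure)
  finally show ?thesis by (simp add: scaleR_conv_of_real mult.commute)
qed

lemma avg_id:
  assumes "f \<in> C n"
  shows "avg n f = f"
proof
  fix x show "avg n f x = f x"
    using integral_C_cell[OF assms, of x] measure_cell(1)[of x n] C_vanish[OF assms]
    by (cases "x \<in> X") (auto simp: avg_def)
qed

lemma avg_integral:
  assumes g: "integrable M g" and h: "h \<in> C n"
  shows "(LINT x|M. avg n g x * h x) = (LINT x|M. g x * h x)"
proof -
  have exp: "(LINT x|M. u x * h x) = (\<Sum>U\<in>cell X n ` X. h (rep U) * (LINT x|M. u x * indicator U x))"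
    if u: "integrable M u" for u :: "_ \<Rightarrow> complex"
  proof -
    have "(LINT x|M. u x * h x) = (LINT x|M. (\<Sum>U\<in>cell X n ` X. h (rep U) * (u x * indicator U x)))"
      by (subst C_expand[OF h]) (simp add: sum_distrib_left mult_ac)
    also have "\<dots> = (\<Sum>U\<in>cell X n ` X. (LINT x|M. h (rep U) * (u x * indicator U x)))"
      using integrable_mult_C[OF u C_indicator_cell] by (intro Bochner_Integration.integral_sum) auto
    finally show ?thesis by simp
  qed
  have "(LINT x|M. avg n g x * indicator U x) = (LINT x|M. g x * indicator U x)"
    if "U \<in> cell X n ` X" for U
  proof -
    from that obtain x where x: "x \<in> X" "U = cell X n x" by blast
    then show ?thesis
      using integral_C_cell[OF avg_in_C x(1), of n g] measure_cell(1)[OF x(1), of n] by (simp add: avg_def)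
  qed
  then show ?thesis
    using exp[OF g] exp[OF L2_integrable[OF C_L2[OF avg_in_C[of n g]]]] by simp
qed

lemma avg_diff:
  assumes "integrable M f" "integrable M g"
  shows "avg n (\<lambda>x. f x - g x) = (\<lambda>x. avg n f x - avg n g x)"
  using integrable_mult_C[OF assms(1) C_indicator_cell] integrable_mult_C[OF assms(2) C_indicator_cell]
  by (auto simp: avg_def left_diff_distrib diff_divide_distrib fun_eq_iff)

lemma avg_sum:
  assumes "\<And>i. i \<in> I \<Longrightarrow> integrable M (f i)"
  shows "avg n (\<lambda>x. \<Sum>i\<in>I. f i x) = (\<lambda>x. \<Sum>i\<in>I. avg n (f i) x)"
  using integrable_mult_C[OF assms C_indicator_cell]
  by (auto simp: avg_def sum_distrib_right sum_divide_distrib fun_eq_iff)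

lemma avg_mult:
  assumes "f \<in> C n"
  shows "avg n (\<lambda>x. f x * g x) = (\<lambda>x. f x * avg n g x)"
proof
  fix x show "avg n (\<lambda>x. f x * g x) x = f x * avg n g x"
  proof (cases "x \<in> X")
    case True
    have "(LINT y|M. f y * g y * indicator (cell X n x) y) = (LINT y|M. f x * (g y * indicator (cell X n x) y))"
      using C_const[OF assms True] by (intro Bochner_Integration.integral_cong) (auto simp: indicator_def)
    then show ?thesis using True by (simp add: avg_def)
  qed (simp add: avg_def)
qed

text \<open>The projections map \<open>L\<^sup>2\<close> into bounded functions, since cells of length \<open>n\<close> are not too small.
  Through this bound, \<open>L\<^sup>2\<close> convergence passes to pointwise statements about \<open>avg n\<close>.\<close>

lemma avg_bound:
  assumes "g \<in> L2 M"
  shows "cmod (avg n g x) \<le> (real R * real n + 1) * l2_norm M g"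
proof (cases "x \<in> X")
  case True
  let ?U = "cell X n x"
  have "cmod (LINT y|M. g y * indicator ?U y) \<le> (LINT y|M. cmod (g y * indicator ?U y))"
    by (rule integral_norm_bound)
  also have "\<dots> \<le> (LINT y|M. cmod (g y))"
  proof (rule integral_mono)
    show "integrable M (\<lambda>y. cmod (g y * indicator ?U y))"
      by (rule integrable_norm[OF integrable_mult_C[OF L2_integrable[OF assms] C_indicator_cell]])
    show "integrable M (\<lambda>y. cmod (g y))" by (rule L2_cmod_integrable[OF assms])
  qed (simp add: norm_mult indicator_def)
  also have "\<dots> \<le> l2_norm M g" by (rule integral_cmod_le_l2_norm[OF assms])
  finally have le: "cmod (LINT y|M. g y * indicator ?U y) \<le> l2_norm M g" .
  have "cmod (avg n g x) = (1 / measure M ?U) * cmod (LINT y|M. g y * indicator ?U y)"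
    using True by (simp add: avg_def norm_divide)
  also have "\<dots> \<le> (real R * real n + 1) * l2_norm M g"
    using le measure_cell[OF True, of n] by (intro mult_mono) auto
  finally show ?thesis .
qed (simp add: avg_def l2_norm_def)

lemma avg_orth:
  assumes "f \<in> l2_orth M (cyl_space X (int j - 1))" "k < j"
  shows "avg k f = (\<lambda>x. 0)"
proof
  fix x
  obtain i where j: "j = Suc i" and i: "k \<le> i" using assms(2) by (cases j) auto
  have "indicator (cell X k x) \<in> C i"
    by (rule C_mono[OF i C_indicator_cell])
  then have "l2_inner M f (indicator (cell X k x)) = 0"
    using assms(1) unfolding l2_orth_def j by simp
  moreover have "cnj (indicator U y) = indicator U y" for U and y :: "int \<Rightarrow> 'a"
    by (simp add: indicator_def)
  ultimately show "avg k f x = 0" by (simp add: avg_def l2_inner_def)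
qed

text \<open>The projection onto \<open>C\<^sub>k\<close> cuts the series off at \<open>k\<close>, because it fixes the earlier terms and kills the later ones.\<close>

lemma avg_of_l2_sums:
  assumes s: "\<And>n. s n \<in> C n \<inter> l2_orth M (cyl_space X (int n - 1))" and sums: "l2_sums M s \<xi>"
  shows "avg k \<xi> x = (\<Sum>j\<le>k. s j x)"
proof -
  have \<xi>: "\<xi> \<in> L2 M" and lim: "(\<lambda>N. l2_norm M (\<lambda>x. \<xi> x - (\<Sum>n<N. s n x))) \<longlonglongrightarrow> 0"
    using sums by (auto simp: l2_sums_def)
  have sL2: "s n \<in> L2 M" for n using s C_L2 by blast
  have sumL2: "(\<lambda>x. \<Sum>n<N. s n x) \<in> L2 M" for N
  proof (rule C_L2[of _ N], rule C_sum)
    fix i assume "i \<in> {..<N}"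
    then show "s i \<in> C N" using C_mono[of i N "s i"] s[of i] by simp
  qed
  have Ps: "avg k (s j) = (if j \<le> k then s j else (\<lambda>x. 0))" for j
  proof (cases "j \<le> k")
    case True
    then show ?thesis using avg_id C_mono s by auto
  next
    case False
    then show ?thesis using avg_orth[of "s j" j k] s by auto
  qed
  have "cmod (avg k \<xi> x - (\<Sum>j\<le>k. s j x)) \<le> (real R * real k + 1) * l2_norm M (\<lambda>x. \<xi> x - (\<Sum>n<N. s n x))"
    if "k < N" for N
  proof -
    have "avg k (\<lambda>x. \<xi> x - (\<Sum>n<N. s n x)) x = avg k \<xi> x - (\<Sum>n<N. avg k (s n) x)"
      using avg_diff[OF L2_integrable[OF \<xi>] L2_integrable[OF sumL2], of k N]
        avg_sum[of "{..<N}" s k] L2_integrable[OF sL2] by simp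
    also have "(\<Sum>n<N. avg k (s n) x) = (\<Sum>n<N. if n \<le> k then s n x else 0)"
      by (intro sum.cong) (simp_all add: Ps)
    also have "\<dots> = (\<Sum>j\<in>{..<N} \<inter> {j. j \<le> k}. s j x)" by (simp add: sum.If_cases)
    also have "{..<N} \<inter> {j. j \<le> k} = {..k}" using that by auto
    finally show ?thesis using avg_bound[OF L2_diff(1)[OF \<xi> sumL2[of N]], of k x] by simp
  qed
  then have "\<forall>\<^sub>F N in sequentially. norm (avg k \<xi> x - (\<Sum>j\<le>k. s j x)) \<le>
      (real R * real k + 1) * l2_norm M (\<lambda>x. \<xi> x - (\<Sum>n<N. s n x))"
    by (intro eventually_sequentiallyI[of "Suc k"]) auto
  moreover have "(\<lambda>N. (real R * real k + 1) * l2_norm M (\<lambda>x. \<xi> x - (\<Sum>n<N. s n x))) \<longlonglongrightarrow> 0"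
    using tendsto_mult_right_zero[OF lim] .
  ultimately have "(\<lambda>N. avg k \<xi> x - (\<Sum>j\<le>k. s j x)) \<longlonglongrightarrow> 0"
    by (rule Lim_null_comparison)
  then show ?thesis by (simp add: LIMSEQ_const_iff)
qed

text \<open>Summation by parts: \<open>\<Sum>j\<le>k. j (avg j - avg (j - 1)) = k avg k - \<Sum>j<k. avg j\<close>.  This expresses the
  operator through projections alone, whose commutators with functions in \<open>C\<^sub>n\<close> are easy.\<close>

lemma dirac_projections:
  assumes "(\<xi>, \<eta>) \<in> dirac X M"
  shows "\<xi> \<in> L2 M" "\<eta> \<in> L2 M"
    and "avg k \<eta> x = of_nat k * avg k \<xi> x - (\<Sum>j<k. avg j \<xi> x)"
    and "(\<lambda>k. LINT x|M. (cmod (\<eta> x - avg k \<eta> x))\<^sup>2) \<longlonglongrightarrow> 0"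
proof -
  obtain s where s: "\<And>n. s n \<in> C n \<inter> l2_orth M (cyl_space X (int n - 1))"
    and \<xi>: "l2_sums M s \<xi>" and \<eta>: "l2_sums M (\<lambda>n x. of_nat n * s n x) \<eta>"
    using assms by (auto simp: dirac_def)
  show "\<xi> \<in> L2 M" "\<eta> \<in> L2 M" using \<xi> \<eta> by (auto simp: l2_sums_def)
  have ns: "(\<lambda>x. of_nat n * s n x) \<in> C n \<inter> l2_orth M (cyl_space X (int n - 1))" for n
  proof
    show *: "(\<lambda>x. of_nat n * s n x) \<in> C n" using s[of n] by (blast intro: C_scale)
    show "(\<lambda>x. of_nat n * s n x) \<in> l2_orth M (cyl_space X (int n - 1))"
      using s[of n] C_L2[OF *] by (auto simp: l2_orth_def l2_inner_def mult.assoc)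
  qed
  have avg\<xi>: "avg k \<xi> x = (\<Sum>j\<le>k. s j x)" for k x by (rule avg_of_l2_sums[OF s \<xi>])
  have avg\<eta>: "avg k \<eta> x = (\<Sum>j\<le>k. of_nat j * s j x)" for k x by (rule avg_of_l2_sums[OF ns \<eta>])
  show "avg k \<eta> x = of_nat k * avg k \<xi> x - (\<Sum>j<k. avg j \<xi> x)"
  proof (induction k)
    case (Suc k)
    have "avg (Suc k) \<eta> x = avg k \<eta> x + of_nat (Suc k) * s (Suc k) x" by (simp add: avg\<eta>)
    also have "s (Suc k) x = avg (Suc k) \<xi> x - avg k \<xi> x" by (simp add: avg\<xi>)
    finally show ?case using Suc by (simp add: algebra_simps)
  qed (simp add: avg\<eta>)
  have "(\<lambda>N. l2_norm M (\<lambda>x. \<eta> x - (\<Sum>n<N. of_nat n * s n x))) \<longlonglongrightarrow> 0"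
    using \<eta> by (simp add: l2_sums_def)
  then have "(\<lambda>N. (l2_norm M (\<lambda>x. \<eta> x - (\<Sum>n<Suc N. of_nat n * s n x)))\<^sup>2) \<longlonglongrightarrow> 0\<^sup>2"
    by (intro tendsto_power) (rule LIMSEQ_Suc)
  then show "(\<lambda>k. LINT x|M. (cmod (\<eta> x - avg k \<eta> x))\<^sup>2) \<longlonglongrightarrow> 0"
    by (simp add: l2_norm_square avg\<eta> lessThan_Suc_atMost)
qed

text \<open>For \<open>f \<in> C n\<close>, multiplication by \<open>f\<close> commutes with \<open>avg j\<close> as soon as \<open>j \<ge> n\<close>, so
  \<open>[D, f] = \<Sum>j<n. [f, avg j]\<close>.  Each of the \<open>n\<close> summands is bounded by a multiple of \<open>\<parallel>f\<parallel>\<close>.\<close>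

lemma commutator_norm_le_1_if_small:
  "\<exists>\<delta>>0. \<forall>f\<in>C n. (\<forall>x. cmod (f x) \<le> \<delta>) \<longrightarrow> commutator_norm X M f \<le> 1"
proof -
  define K where "K = real R * real n + 1"
  \<comment> \<open>Chosen so that \<open>cmod (G x) \<le> 1 / 2\<close> below, which leaves room for the factor 2 in \<open>L2_add\<close>.\<close>
  define \<delta> where "\<delta> = 1 / (4 * (real n * K + 1))"
  have K: "1 \<le> K" by (simp add: K_def)
  have \<delta>: "0 < \<delta>" using K by (simp add: \<delta>_def add_nonneg_pos)
  have "4 * (real n * K + 1) * \<delta> = 1" using K by (simp add: \<delta>_def add_nonneg_eq_0_iff)
  then have \<delta>K: "2 * real n * K * \<delta> \<le> 1 / 2" using \<delta> by (simp add: algebra_simps)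
  show ?thesis
  proof (intro exI[of _ \<delta>] conjI ballI impI \<delta>)
    fix f assume f: "f \<in> C n" and small: "\<forall>x. cmod (f x) \<le> \<delta>"
    have "l2_norm M (\<lambda>x. \<zeta> x - f x * \<eta> x) \<le> 1"
      if d1: "(\<xi>, \<eta>) \<in> dirac X M" and d2: "(\<lambda>x. f x * \<xi> x, \<zeta>) \<in> dirac X M"
        and unit: "l2_norm M \<xi> \<le> 1" for \<xi> \<eta> \<zeta>
    proof -
      note \<xi> = dirac_projections(1)[OF d1] and \<eta> = dirac_projections(2)[OF d1]
        and \<zeta> = dirac_projections(2)[OF d2] and f\<xi> = dirac_projections(1)[OF d2]
      \<comment> \<open>\<open>G\<close> is the finite sum of commutators applied to \<open>\<xi>\<close>, with which \<open>[D, f] \<xi>\<close> agrees almost everywhere.\<close>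
      define G where "G x = (\<Sum>j<n. f x * avg j \<xi> x - avg j (\<lambda>x. f x * \<xi> x) x)" for x
      have PG: "avg N \<zeta> x - f x * avg N \<eta> x = G x" if "n \<le> N" for N x
      proof -
        have Pf: "avg j (\<lambda>x. f x * \<xi> x) x = f x * avg j \<xi> x" if "n \<le> j" for j
          using avg_mult[OF C_mono[OF that f]] by metis
        have "avg N \<zeta> x - f x * avg N \<eta> x = (\<Sum>j<N. f x * avg j \<xi> x - avg j (\<lambda>x. f x * \<xi> x) x)"
          unfolding dirac_projections(3)[OF d1] dirac_projections(3)[OF d2] Pf[OF that]
          by (simp add: algebra_simps sum_subtractf sum_distrib_left)
        also have "\<dots> = G x"
          unfolding G_def using that Pf by (intro sum.mono_neutral_right) auto
        finally show ?thesis .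
      qed
      have GC: "G \<in> C n"
        unfolding G_def[abs_def]
        by (intro C_sum C_diff C_mult f) (auto intro!: C_mono[OF _ avg_in_C])
      have diff: "(\<lambda>x. \<zeta> x - f x * \<eta> x) \<in> L2 M"
        by (intro L2_diff L2_C_mult[OF f] \<zeta> \<eta>)
      have l2f\<xi>: "l2_norm M (\<lambda>x. f x * \<xi> x) \<le> \<delta>"
      proof -
        have "(LINT x|M. (cmod (f x * \<xi> x))\<^sup>2) \<le> (LINT x|M. \<delta>\<^sup>2 * (cmod (\<xi> x))\<^sup>2)"
          using small L2_square_integrable[OF f\<xi>] L2_square_integrable[OF \<xi>]
          by (intro integral_mono) (auto simp: norm_mult power_mult_distrib intro!: mult_right_mono power_mono)
        also have "\<dots> \<le> \<delta>\<^sup>2"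
        proof -
          have "(LINT x|M. (cmod (\<xi> x))\<^sup>2) \<le> 1"
            using unit unfolding l2_norm_def by simp
          then show ?thesis using \<delta> by simp
        qed
        finally show ?thesis unfolding l2_norm_def using \<delta> real_sqrt_le_mono by fastforce
      qed
      have G: "cmod (G x) \<le> 1 / 2" for x
      proof -
        have "cmod (f x * avg j \<xi> x - avg j (\<lambda>x. f x * \<xi> x) x) \<le> 2 * K * \<delta>" if "j < n" for j
        proof -
          have Kj: "real R * real j + 1 \<le> K" using that by (simp add: K_def mult_left_mono)
          have "cmod (avg j \<xi> x) \<le> (real R * real j + 1) * l2_norm M \<xi>" by (rule avg_bound[OF \<xi>])
          also have "\<dots> \<le> K * 1" using Kj unit K by (intro mult_mono) (auto simp: l2_norm_def)
          finally have 1: "cmod (f x * avg j \<xi> x) \<le> K * \<delta>"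
            using small \<delta> K mult_mono[of "cmod (f x)" \<delta> "cmod (avg j \<xi> x)" K] by (simp add: norm_mult mult.commute)
          have "cmod (avg j (\<lambda>x. f x * \<xi> x) x) \<le> (real R * real j + 1) * l2_norm M (\<lambda>x. f x * \<xi> x)"
            by (rule avg_bound[OF f\<xi>])
          also have "\<dots> \<le> K * \<delta>" using Kj l2f\<xi> K by (intro mult_mono) (auto simp: l2_norm_def)
          finally show ?thesis
            using 1 norm_triangle_ineq4[of "f x * avg j \<xi> x" "avg j (\<lambda>x. f x * \<xi> x) x"]
            unfolding mult.assoc by linarith
        qed
        then have "cmod (G x) \<le> (\<Sum>j<n. 2 * K * \<delta>)"
          unfolding G_def by (intro order_trans[OF norm_sum] sum_mono) auto
        also have "\<dots> = 2 * real n * K * \<delta>" by simp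
        finally show ?thesis using \<delta>K by linarith
      qed
      have "(LINT x|M. (cmod (\<zeta> x - f x * \<eta> x - G x))\<^sup>2) \<le> 0"
      proof (rule LIMSEQ_le)
        show "(\<lambda>N::nat. LINT x|M. (cmod (\<zeta> x - f x * \<eta> x - G x))\<^sup>2)
            \<longlonglongrightarrow> (LINT x|M. (cmod (\<zeta> x - f x * \<eta> x - G x))\<^sup>2)" by simp
        have "(\<lambda>N. 2 * (LINT x|M. (cmod (\<zeta> x - avg N \<zeta> x))\<^sup>2)
            + 2 * (\<delta>\<^sup>2 * (LINT x|M. (cmod (\<eta> x - avg N \<eta> x))\<^sup>2))) \<longlonglongrightarrow> 2 * 0 + 2 * (\<delta>\<^sup>2 * 0)"
          by (intro tendsto_intros dirac_projections(4)[OF d1] dirac_projections(4)[OF d2])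
        then show "(\<lambda>N. 2 * (LINT x|M. (cmod (\<zeta> x - avg N \<zeta> x))\<^sup>2)
            + 2 * (\<delta>\<^sup>2 * (LINT x|M. (cmod (\<eta> x - avg N \<eta> x))\<^sup>2))) \<longlonglongrightarrow> 0" by simp
        show "\<exists>N0. \<forall>N\<ge>N0. (LINT x|M. (cmod (\<zeta> x - f x * \<eta> x - G x))\<^sup>2)
            \<le> 2 * (LINT x|M. (cmod (\<zeta> x - avg N \<zeta> x))\<^sup>2) + 2 * (\<delta>\<^sup>2 * (LINT x|M. (cmod (\<eta> x - avg N \<eta> x))\<^sup>2))"
        proof (intro exI[of _ n] allI impI)
          fix N assume N: "n \<le> N"
          have u: "(\<lambda>x. \<zeta> x - avg N \<zeta> x) \<in> L2 M" and v: "(\<lambda>x. \<eta> x - avg N \<eta> x) \<in> L2 M"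
            by (intro L2_diff \<zeta> \<eta> C_L2[OF avg_in_C])+
          have fv: "(\<lambda>x. f x * (\<eta> x - avg N \<eta> x)) \<in> L2 M" by (rule L2_C_mult[OF f v])
          have "(LINT x|M. (cmod (\<zeta> x - f x * \<eta> x - G x))\<^sup>2)
              = (LINT x|M. (cmod ((\<zeta> x - avg N \<zeta> x) - f x * (\<eta> x - avg N \<eta> x)))\<^sup>2)"
            unfolding PG[OF N, symmetric] by (simp add: algebra_simps)
          also have "\<dots> \<le> 2 * (LINT x|M. (cmod (\<zeta> x - avg N \<zeta> x))\<^sup>2)
              + 2 * (LINT x|M. (cmod (f x * (\<eta> x - avg N \<eta> x)))\<^sup>2)"
            by (rule L2_diff(2)[OF u fv])
          also have "(LINT x|M. (cmod (f x * (\<eta> x - avg N \<eta> x)))\<^sup>2)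
              \<le> (LINT x|M. \<delta>\<^sup>2 * (cmod (\<eta> x - avg N \<eta> x))\<^sup>2)"
            using small L2_square_integrable[OF fv] L2_square_integrable[OF v]
            by (intro integral_mono) (auto simp: norm_mult power_mult_distrib intro!: mult_right_mono power_mono)
          finally show "(LINT x|M. (cmod (\<zeta> x - f x * \<eta> x - G x))\<^sup>2)
            \<le> 2 * (LINT x|M. (cmod (\<zeta> x - avg N \<zeta> x))\<^sup>2) + 2 * (\<delta>\<^sup>2 * (LINT x|M. (cmod (\<eta> x - avg N \<eta> x))\<^sup>2))"
            by simp
        qed
      qed
      moreover have "(LINT x|M. (cmod (G x))\<^sup>2) \<le> (LINT x|M. (1 / 2)\<^sup>2)"
        using G L2_square_integrable[OF C_L2[OF GC]] by (intro integral_mono power_mono) auto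
      moreover have "(LINT x|M. (cmod (\<zeta> x - f x * \<eta> x - G x + G x))\<^sup>2)
          \<le> 2 * (LINT x|M. (cmod (\<zeta> x - f x * \<eta> x - G x))\<^sup>2) + 2 * (LINT x|M. (cmod (G x))\<^sup>2)"
        by (intro L2_add(2) L2_diff(1)[OF diff] C_L2[OF GC])
      ultimately have "(LINT x|M. (cmod (\<zeta> x - f x * \<eta> x))\<^sup>2) \<le> 1"
        by (simp add: power2_eq_square prob_space)
      then show ?thesis by (simp add: l2_norm_def)
    qed
    then show "commutator_norm X M f \<le> 1"
      unfolding commutator_norm_def by (intro SUP_least) (auto simp: ennreal_le_1)
  qed
qed

lemma avg_increment_orth:
  assumes "integrable M f" "g \<in> C j"
  shows "(LINT x|M. (avg (Suc j) f x - avg j f x) * g x) = 0"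
proof -
  have "integrable M (avg k f)" for k by (rule L2_integrable[OF C_L2[OF avg_in_C]])
  note int = integrable_mult_C[OF this assms(2)]
  have "(LINT x|M. (avg (Suc j) f x - avg j f x) * g x) =
      (LINT x|M. avg (Suc j) f x * g x) - (LINT x|M. avg j f x * g x)"
    using int by (simp add: left_diff_distrib)
  also have "\<dots> = 0"
    using avg_integral[OF assms(1) C_mono[OF _ assms(2), of "Suc j"]] avg_integral[OF assms] by simp
  finally show ?thesis .
qed

text \<open>The constant function 1 lies in the domain of the operator and is mapped to 0, so the commutator sends it to
  \<open>D f = \<Sum>j j (avg j f - avg (j - 1) f)\<close>.  The increments are orthogonal, hence the left hand side is
  \<open>\<parallel>D f\<parallel>\<^sup>2\<close>.\<close>

lemma commutator_norm_imp_increments: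
  assumes f: "f \<in> C n" and comm: "commutator_norm X M f \<le> 1"
  shows "(\<Sum>j<n. (real (Suc j))\<^sup>2 * (LINT x|M. (cmod (avg (Suc j) f x - avg j f x))\<^sup>2)) \<le> 1"
proof -
  define s where "s j = (case j of 0 \<Rightarrow> avg 0 f | Suc i \<Rightarrow> (\<lambda>x. avg (Suc i) f x - avg i f x))" for j
  define \<zeta> where "\<zeta> x = (\<Sum>j<Suc n. of_nat j * s j x)" for x
  have fi: "integrable M f" using L2_integrable[OF C_L2[OF f]] .
  have sC: "s j \<in> C j" for j
  proof (cases j)
    case 0
    then show ?thesis using avg_in_C[of 0 f] by (simp add: s_def)
  next
    case (Suc i)
    then show ?thesis
      using C_diff[OF avg_in_C[of "Suc i" f] C_mono[OF _ avg_in_C[of i f], of "Suc i"]] by (simp add: s_def)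
  qed
  have s_orth: "(LINT x|M. s j x * cnj (g x)) = 0" if g: "g \<in> C i" and ij: "i < j" for i j g
  proof -
    obtain k where k: "j = Suc k" using ij by (cases j) auto
    then have "g \<in> C k" using C_mono[OF _ g, of k] ij by simp
    then show ?thesis using avg_increment_orth[OF fi C_cnj, of g k] by (simp add: s_def k)
  qed
  have so: "s j \<in> l2_orth M (cyl_space X (int j - 1))" for j
  proof (cases j)
    case 0
    then show ?thesis using C_L2[OF sC[of j]] by (simp add: l2_orth_def l2_inner_def cyl_space_def)
  next
    case (Suc i)
    then show ?thesis using C_L2[OF sC[of j]] s_orth[of _ i j] by (auto simp: l2_orth_def l2_inner_def)
  qed
  have s0: "s j = (\<lambda>x. 0)" if nj: "n < j" for j
  proof -
    obtain k where k: "j = Suc k" using nj by (cases j) auto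
    then show ?thesis using nj avg_id[OF C_mono[OF _ f]] by (simp add: s_def)
  qed
  have telescope: "(\<Sum>j<Suc k. s j x) = avg k f x" for k x
    by (induction k) (simp_all add: s_def)
  have d1: "(indicator X, \<lambda>x. 0) \<in> dirac X M"
  proof -
    define u :: "nat \<Rightarrow> (int \<Rightarrow> 'a) \<Rightarrow> complex" where "u j = (if j = 0 then indicator X else (\<lambda>x. 0))" for j
    have "l2_sums M u (indicator X)"
      unfolding l2_sums_def
    proof (intro conjI C_L2[OF C_indicator_space] tendsto_eventually eventually_sequentiallyI[of 1])
      fix N :: nat assume "1 \<le> N"
      then have "(\<Sum>n<N. u n x) = indicator X x" for x
        by (cases N) (simp_all add: u_def sum.lessThan_Suc_shift del: sum.lessThan_Suc)
      then show "l2_norm M (\<lambda>x. indicator X x - (\<Sum>n<N. u n x)) = 0" by (simp add: l2_norm_def)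
    qed
    moreover have "l2_sums M (\<lambda>n x. of_nat n * u n x) (\<lambda>x. 0)"
    proof -
      have "(\<Sum>n<N. of_nat n * u n x) = 0" for N x by (intro sum.neutral) (simp add: u_def)
      then show ?thesis using C_L2[OF C_zero] by (simp add: l2_sums_def l2_norm_def)
    qed
    moreover have "u j \<in> C j \<inter> l2_orth M (cyl_space X (int j - 1))" for j
    proof
      show "u j \<in> C j"
        using C_zero[of j] C_indicator_space[of j] by (cases "j = 0") (auto simp: u_def)
      show "u j \<in> l2_orth M (cyl_space X (int j - 1))"
      proof (cases "j = 0")
        case True
        then have "cyl_space X (int j - 1) = {\<lambda>_. 0}" by (simp add: cyl_space_def)
        then show ?thesis using True C_L2[OF C_indicator_space] by (simp add: u_def l2_orth_def l2_inner_def)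
      next
        case False
        then show ?thesis using C_L2[OF C_zero] by (simp add: u_def l2_orth_def l2_inner_def)
      qed
    qed
    moreover have "summable (\<lambda>n. (real n * l2_norm M (u n))\<^sup>2)"
      by (rule summable_finite[of "{}"]) (auto simp: u_def l2_norm_def)
    ultimately show ?thesis unfolding dirac_def by blast
  qed
  have d2: "(\<lambda>x. f x * indicator X x, \<zeta>) \<in> dirac X M"
  proof -
    have f_eq: "(\<lambda>x. f x * indicator X x) = f"
    proof
      fix x show "f x * indicator X x = f x" using C_vanish[OF f, of x] by (cases "x \<in> X") auto
    qed
    have "l2_sums M s f"
      unfolding l2_sums_def
    proof (intro conjI C_L2[OF f] tendsto_eventually eventually_sequentiallyI[of "Suc n"])
      fix N assume "Suc n \<le> N"
      then obtain k where k: "N = Suc k" "n \<le> k" by (cases N) auto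
      have "(\<Sum>j<N. s j x) = f x" for x
        unfolding k telescope using avg_id[OF C_mono[OF k(2) f]] by simp
      then show "l2_norm M (\<lambda>x. f x - (\<Sum>j<N. s j x)) = 0" by (simp add: l2_norm_def)
    qed
    moreover have "l2_sums M (\<lambda>n x. of_nat n * s n x) \<zeta>"
      unfolding l2_sums_def
    proof (intro conjI tendsto_eventually eventually_sequentiallyI[of "Suc n"])
      show "\<zeta> \<in> L2 M"
        unfolding \<zeta>_def[abs_def] by (intro C_L2[of _ n] C_sum C_scale C_mono[OF _ sC]) auto
      fix N assume "Suc n \<le> N"
      then have "(\<Sum>j<N. of_nat j * s j x) = \<zeta> x" for x
        unfolding \<zeta>_def using s0 by (intro sum.mono_neutral_right) auto
      then show "l2_norm M (\<lambda>x. \<zeta> x - (\<Sum>j<N. of_nat j * s j x)) = 0" by (simp add: l2_norm_def)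
    qed
    moreover have "summable (\<lambda>j. (real j * l2_norm M (s j))\<^sup>2)"
      by (rule summable_finite[of "{..n}"]) (auto simp: s0 l2_norm_def)
    ultimately show ?thesis
      unfolding dirac_def f_eq using sC so by blast
  qed
  have "l2_norm M (indicator X) \<le> 1"
  proof -
    have "(LINT x|M. (cmod (indicator X x))\<^sup>2) = (LINT x|M. 1)"
      by (rule Bochner_Integration.integral_cong) (auto simp: space_eq)
    then show ?thesis by (simp add: l2_norm_def prob_space)
  qed
  then have "ennreal (l2_norm M (\<lambda>x. \<zeta> x - f x * 0)) \<le> commutator_norm X M f"
    unfolding commutator_norm_def using d1 d2
    by (intro SUP_upper2[of "(indicator X, \<lambda>x. 0, \<zeta>)"]) auto
  also have "\<dots> \<le> 1" by (rule comm)
  finally have "ennreal (l2_norm M \<zeta>) \<le> 1" by simp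
  then have le1: "(LINT x|M. (cmod (\<zeta> x))\<^sup>2) \<le> 1"
    unfolding l2_norm_def by (simp add: ennreal_le_1)
  have ss: "integrable M (\<lambda>x. s i x * cnj (s j x))" for i j
    using integrable_mult_C[OF L2_integrable[OF C_L2[OF sC[of i]]] C_cnj[OF sC[of j]]] .
  have orth: "(LINT x|M. s i x * cnj (s j x)) = 0" if "i \<noteq> j" for i j
  proof (cases "j < i")
    case True
    then show ?thesis using s_orth[OF sC] by blast
  next
    case False
    then have "(LINT x|M. s j x * cnj (s i x)) = 0" using that s_orth[OF sC, of i j] by simp
    moreover have "(LINT x|M. s i x * cnj (s j x)) = (LINT x|M. cnj (s j x * cnj (s i x)))"
      by (simp add: mult.commute)
    ultimately show ?thesis by (simp only: Bochner_Integration.integral_cnj complex_cnj_zero)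
  qed
  have diag: "(LINT x|M. s i x * cnj (s i x)) = of_real (LINT x|M. (cmod (s i x))\<^sup>2)" for i
    by (simp add: complex_norm_square[symmetric] flip: of_real_power)
  have "complex_of_real (LINT x|M. (cmod (\<zeta> x))\<^sup>2) = (LINT x|M. \<zeta> x * cnj (\<zeta> x))"
    by (simp add: complex_norm_square[symmetric] flip: of_real_power)
  also have "\<dots> = (LINT x|M. (\<Sum>i<Suc n. \<Sum>j<Suc n. (of_nat i * of_nat j) * (s i x * cnj (s j x))))"
    unfolding \<zeta>_def cnj_sum sum_product by (simp only: complex_cnj_mult complex_cnj_of_nat mult_ac)
  also have "\<dots> = (\<Sum>i<Suc n. \<Sum>j<Suc n. (of_nat i * of_nat j) * (LINT x|M. s i x * cnj (s j x)))"
    using ss by (simp only: Bochner_Integration.integral_sum Bochner_Integration.integrable_sum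
        integrable_mult_right integral_mult_right_zero)
  also have "\<dots> = (\<Sum>i<Suc n. \<Sum>j<Suc n. if j = i then of_nat i * of_nat i * (LINT x|M. s i x * cnj (s i x)) else 0)"
    using orth by (intro sum.cong) auto
  also have "\<dots> = (\<Sum>i<Suc n. of_nat i * of_nat i * (LINT x|M. s i x * cnj (s i x)))"
    by (intro sum.cong) (auto simp: sum.delta simp del: sum.lessThan_Suc)
  also have "\<dots> = of_real (\<Sum>i<Suc n. (real i)\<^sup>2 * (LINT x|M. (cmod (s i x))\<^sup>2))"
    by (simp only: diag of_real_sum of_real_mult of_real_power of_real_of_nat_eq power2_eq_square)
  finally have "(LINT x|M. (cmod (\<zeta> x))\<^sup>2) = (\<Sum>i<Suc n. (real i)\<^sup>2 * (LINT x|M. (cmod (s i x))\<^sup>2))"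
    by (simp only: of_real_eq_iff)
  also have "\<dots> = (\<Sum>j<n. (real (Suc j))\<^sup>2 * (LINT x|M. (cmod (avg (Suc j) f x - avg j f x))\<^sup>2))"
    by (subst sum.lessThan_Suc_shift) (simp add: s_def)
  finally show ?thesis using le1 by simp
qed

text \<open>The function \<open>f - avg N f\<close> is the sum of the increments beyond \<open>N\<close>, and at \<open>x\<close> only those contribute at
  which the cell of \<open>x\<close> splits.  The increment from \<open>j\<close> to \<open>Suc j\<close> is constant on the cell of
  length \<open>Suc j\<close>, which has measure at least \<open>1 / (R * Suc j)\<close>
  and therefore bounds its value by its \<open>L\<^sup>2\<close> norm.  The weights \<open>Suc j\<close>
  come from the preceding lemma through the Cauchy-Schwarz inequality.\<close>

lemma pointwise_deviation:
  assumes f: "f \<in> C n" and comm: "commutator_norm X M f \<le> 1" and x: "x \<in> X"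
  shows "(cmod (f x - avg N f x))\<^sup>2
    \<le> real R * (\<Sum>j | N \<le> j \<and> j < n \<and> cell X (Suc j) x \<noteq> cell X j x. 1 / real (Suc j))"
proof (cases "N \<le> n")
  case False
  then show ?thesis using avg_id[OF C_mono[OF _ f]] by (simp add: sum_nonneg)
next
  case True
  define I where "I = {j. N \<le> j \<and> j < n \<and> cell X (Suc j) x \<noteq> cell X j x}"
  define D where "D j y = avg (Suc j) f y - avg j f y" for j y
  define q where "q j = (LINT y|M. (cmod (D j y))\<^sup>2)" for j
  have I: "finite I" "I \<subseteq> {..<n}" by (auto simp: I_def)
  have q0: "0 \<le> q j" for j unfolding q_def by simp
  have DC: "D j \<in> C (Suc j)" for j
    unfolding D_def[abs_def] by (intro C_diff avg_in_C C_mono[OF _ avg_in_C]) simp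
  have D_le: "(cmod (D j x))\<^sup>2 \<le> real R * real (Suc j) * q j" for j
  proof -
    let ?U = "cell X (Suc j) x"
    have "(cmod (D j x))\<^sup>2 * measure M ?U = (LINT y|M. (cmod (D j x))\<^sup>2 * indicator ?U y)"
      using cell_measurable[of "Suc j" x] by (simp add: measure_def[symmetric] Int_absorb2 sets.sets_into_space)
    also have "\<dots> \<le> q j"
      unfolding q_def
    proof (rule integral_mono)
      show "integrable M (\<lambda>y. (cmod (D j x))\<^sup>2 * indicator ?U y)"
        using cell_measurable[of "Suc j" x] by (simp add: emeasure_eq_measure)
      show "integrable M (\<lambda>y. (cmod (D j y))\<^sup>2)" using L2_square_integrable[OF C_L2[OF DC]] .
      show "(cmod (D j x))\<^sup>2 * indicator ?U y \<le> (cmod (D j y))\<^sup>2" for y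
        using C_const[OF DC x] by (auto simp: indicator_def)
    qed
    finally have le: "(cmod (D j x))\<^sup>2 * measure M ?U \<le> q j" .
    have "(cmod (D j x))\<^sup>2 = (cmod (D j x))\<^sup>2 * measure M ?U * (1 / measure M ?U)"
      using measure_cell(1)[OF x, of "Suc j"] by simp
    also have "\<dots> \<le> q j * (real R * real (Suc j))"
      using le inverse_measure_cell_le(2)[OF x, of "Suc j"] q0 measure_cell(1)[OF x, of "Suc j"]
      by (intro mult_mono) auto
    finally show ?thesis by (simp add: mult_ac)
  qed
  have "f x - avg N f x = (\<Sum>j = N..<n. D j x)"
    unfolding D_def using True avg_id[OF f] sum_Suc_diff'[of N n "\<lambda>j. avg j f x"] by simp
  also have "\<dots> = (\<Sum>j\<in>I. D j x)"
  proof (rule sum.mono_neutral_right)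
    show "\<forall>j\<in>{N..<n} - I. D j x = 0" by (auto simp: I_def D_def avg_def)
  qed (auto simp: I_def)
  finally have "cmod (f x - avg N f x) \<le> (\<Sum>j\<in>I. cmod (D j x))" by (simp add: norm_sum)
  also have "\<dots> \<le> (\<Sum>j\<in>I. sqrt (real R / real (Suc j)) * (real (Suc j) * sqrt (q j)))"
  proof (rule sum_mono)
    fix j
    have "cmod (D j x) \<le> sqrt (real R * real (Suc j) * q j)"
      using D_le by (rule real_le_rsqrt)
    also have "real R * real (Suc j) * q j = (real R / real (Suc j)) * ((real (Suc j))\<^sup>2 * q j)"
      by (simp add: power2_eq_square)
    also have "sqrt \<dots> = sqrt (real R / real (Suc j)) * (real (Suc j) * sqrt (q j))"
      unfolding real_sqrt_mult real_sqrt_abs by simp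
    finally show "cmod (D j x) \<le> sqrt (real R / real (Suc j)) * (real (Suc j) * sqrt (q j))" .
  qed
  finally have "(cmod (f x - avg N f x))\<^sup>2
      \<le> (\<Sum>j\<in>I. sqrt (real R / real (Suc j)) * (real (Suc j) * sqrt (q j)))\<^sup>2"
    by (intro power_mono) auto
  also have "\<dots> \<le> (\<Sum>j\<in>I. (sqrt (real R / real (Suc j)))\<^sup>2) * (\<Sum>j\<in>I. (real (Suc j) * sqrt (q j))\<^sup>2)"
    by (rule Cauchy_Schwarz_ineq_sum)
  also have "\<dots> = (\<Sum>j\<in>I. real R / real (Suc j)) * (\<Sum>j\<in>I. (real (Suc j))\<^sup>2 * q j)"
    using q0 by (simp add: power_mult_distrib del: of_nat_Suc)
  also have "\<dots> \<le> (\<Sum>j\<in>I. real R / real (Suc j)) * 1"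
  proof (rule mult_left_mono)
    have "(\<Sum>j\<in>I. (real (Suc j))\<^sup>2 * q j) \<le> (\<Sum>j<n. (real (Suc j))\<^sup>2 * q j)"
      using I q0 by (intro sum_mono2) auto
    also have "\<dots> \<le> 1" unfolding q_def D_def by (rule commutator_norm_imp_increments[OF f comm])
    finally show "(\<Sum>j\<in>I. (real (Suc j))\<^sup>2 * q j) \<le> 1" .
  qed (simp add: sum_nonneg)
  finally show ?thesis by (simp add: I_def sum_distrib_left)
qed

end

lemma cell_measure_of_linearly_recurrent:
  assumes "finite A" "linearly_recurrent A X" "invariant_prob_measure A X M"
  obtains R where "linearly_recurrent_words X R" "cell_measure M X R"
proof -
  obtain R where R: "linearly_recurrent_words X R"
    using linearly_recurrent_imp_words[OF assms(1,2)] .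
  have X: "subshift A X" using assms(2) by (simp add: linearly_recurrent_def minimal_subshift_def)
  then have sh: "shift ` X = X" by (simp add: subshift_def)
  interpret linearly_recurrent_words X R by fact
  interpret prob_space M using assms(3) by (simp add: invariant_prob_measure_def)
  have op: "\<And>U. openin (subshift_top A X) U \<Longrightarrow> U \<in> sets M"
    using assms(3) by (auto simp: invariant_prob_measure_def)
  have "cell_measure M X R"
  proof
    show "space M = X" using assms(3) by (simp add: invariant_prob_measure_def)
    show "shift ` X = X" by (rule sh)
    show "finite (words X n)" for n using finite_factors by (simp add: words_eq_factors[OF sh])
    show "cell X n x \<in> sets M" for n x by (rule op[OF openin_cell[OF X]])
    show "0 < R" by (rule R_pos)
    show "1 / (real R * real n) \<le> measure M (cell X n x)" if "x \<in> X" "0 < n" for n x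
      by (rule measure_cell_ge[OF R X assms(3) that])
  qed
  with R show thesis by (rule that)
qed

section \<open>States\<close>

lemma cont_functions_add:
  "f \<in> cont_functions A X \<Longrightarrow> g \<in> cont_functions A X \<Longrightarrow> (\<lambda>x. f x + g x) \<in> cont_functions A X"
  by (auto simp: cont_functions_def intro: continuous_map_add)

lemma cont_functions_compose:
  assumes "f \<in> cont_functions A X" "continuous_on UNIV h" "h 0 = 0"
  shows "(\<lambda>x. h (f x)) \<in> cont_functions A X"
proof -
  have "continuous_map (subshift_top A X) euclidean (h \<circ> f)"
    using assms by (intro continuous_map_compose[of _ euclidean]) (auto simp: cont_functions_def)
  then show ?thesis using assms by (simp add: cont_functions_def o_def)
qed

lemma cont_functions_scale: "f \<in> cont_functions A X \<Longrightarrow> (\<lambda>x. c * f x) \<in> cont_functions A X"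
  by (rule cont_functions_compose[of f A X "\<lambda>z. c * z"]) (auto intro!: continuous_intros)

lemma cont_functions_indicator: "indicator X \<in> cont_functions A X"
proof -
  have "continuous_map (subshift_top A X) euclidean (indicator X :: _ \<Rightarrow> complex)"
    by (rule continuous_map_eq[of _ _ "\<lambda>_. 1"]) auto
  then show ?thesis by (simp add: cont_functions_def)
qed

lemma states_subset_extensional: "states A X \<subseteq> extensional (cont_functions A X)"
  by (auto simp: states_def)

lemma state_add:
  "\<phi> \<in> states A X \<Longrightarrow> f \<in> cont_functions A X \<Longrightarrow> g \<in> cont_functions A X \<Longrightarrow>
    \<phi> (\<lambda>x. f x + g x) = \<phi> f + \<phi> g"
  and state_scale: "\<phi> \<in> states A X \<Longrightarrow> f \<in> cont_functions A X \<Longrightarrow> \<phi> (\<lambda>x. c * f x) = c * \<phi> f"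
  and state_nonneg: "\<phi> \<in> states A X \<Longrightarrow> f \<in> cont_functions A X \<Longrightarrow>
    (\<And>x. x \<in> X \<Longrightarrow> f x \<in> \<real>\<^sub>\<ge>\<^sub>0) \<Longrightarrow> \<phi> f \<in> \<real>\<^sub>\<ge>\<^sub>0"
  and state_unit: "\<phi> \<in> states A X \<Longrightarrow> \<phi> (indicator X) = 1"
  by (simp_all add: states_def)

lemma state_diff:
  assumes "\<phi> \<in> states A X" "f \<in> cont_functions A X" "g \<in> cont_functions A X"
  shows "\<phi> (\<lambda>x. f x - g x) = \<phi> f - \<phi> g"
  using state_add[OF assms(1,2) cont_functions_scale[OF assms(3), of "-1"]]
    state_scale[OF assms(1,3), of "-1"] by simp

lemma state_sum:
  assumes "\<phi> \<in> states A X" "finite I" "\<And>i. i \<in> I \<Longrightarrow> h i \<in> cont_functions A X"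
  shows "\<phi> (\<lambda>x. \<Sum>i\<in>I. c i * h i x) = (\<Sum>i\<in>I. c i * \<phi> (h i))"
proof -
  have "\<phi> (\<lambda>x. \<Sum>i\<in>I. c i * h i x) = (\<Sum>i\<in>I. c i * \<phi> (h i))
      \<and> (\<lambda>x. \<Sum>i\<in>I. c i * h i x) \<in> cont_functions A X"
    using assms(2,3)
  proof (induction I rule: finite_induct)
    case empty
    show ?case
      using state_scale[OF assms(1) cont_functions_indicator, of 0]
        cont_functions_scale[OF cont_functions_indicator, of 0] by simp
  next
    case (insert i I)
    then have hi: "h i \<in> cont_functions A X" by simp
    note h = cont_functions_scale[OF hi, of "c i"] and \<phi>h = state_scale[OF assms(1) hi, of "c i"]
    show ?case
      using insert state_add[OF assms(1) h, of "\<lambda>x. \<Sum>i\<in>I. c i * h i x"]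
        cont_functions_add[OF h, of "\<lambda>x. \<Sum>i\<in>I. c i * h i x"] \<phi>h by simp
  qed
  then show ?thesis ..
qed

lemma cont_functions_diff:
  "f \<in> cont_functions A X \<Longrightarrow> g \<in> cont_functions A X \<Longrightarrow> (\<lambda>x. f x - g x) \<in> cont_functions A X"
  using cont_functions_add[OF _ cont_functions_scale[of g A X "-1"], of f] by simp

lemma cmod_state_real_le:
  assumes \<phi>: "\<phi> \<in> states A X" and f: "(\<lambda>x. of_real (u x)) \<in> cont_functions A X"
    and b: "\<And>x. x \<in> X \<Longrightarrow> \<bar>u x\<bar> \<le> b"
  shows "cmod (\<phi> (\<lambda>x. of_real (u x))) \<le> b"
proof -
  let ?f = "\<lambda>x. of_real (u x) :: complex" and ?b = "\<lambda>x. of_real b * indicator X x :: complex"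
  have bC: "?b \<in> cont_functions A X" by (intro cont_functions_scale cont_functions_indicator)
  have \<phi>b: "\<phi> ?b = of_real b"
    using state_scale[OF \<phi> cont_functions_indicator] state_unit[OF \<phi>] by simp
  have "\<phi> (\<lambda>x. ?b x + ?f x) \<in> \<real>\<^sub>\<ge>\<^sub>0"
  proof (rule state_nonneg[OF \<phi> cont_functions_add[OF bC f]])
    fix x assume "x \<in> X"
    then show "?b x + ?f x \<in> \<real>\<^sub>\<ge>\<^sub>0" using b[of x] by (simp flip: of_real_add)
  qed
  moreover have "\<phi> (\<lambda>x. ?b x - ?f x) \<in> \<real>\<^sub>\<ge>\<^sub>0"
  proof (rule state_nonneg[OF \<phi> cont_functions_diff[OF bC f]])
    fix x assume "x \<in> X"
    then show "?b x - ?f x \<in> \<real>\<^sub>\<ge>\<^sub>0" using b[of x] by (simp flip: of_real_diff)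
  qed
  ultimately have "of_real b + \<phi> ?f \<in> \<real>\<^sub>\<ge>\<^sub>0" "of_real b - \<phi> ?f \<in> \<real>\<^sub>\<ge>\<^sub>0"
    using state_add[OF \<phi> bC f] state_diff[OF \<phi> bC f] \<phi>b by simp_all
  then have "Im (\<phi> ?f) = 0" "\<bar>Re (\<phi> ?f)\<bar> \<le> b"
    by (auto simp: complex_nonneg_Reals_iff)
  then show ?thesis using cmod_eq_Re by auto
qed

text \<open>The factor 2 comes from treating the real and the imaginary part separately.\<close>

lemma cmod_state_le:
  assumes \<phi>: "\<phi> \<in> states A X" and f: "f \<in> cont_functions A X"
    and b: "\<And>x. x \<in> X \<Longrightarrow> cmod (f x) \<le> b"
  shows "cmod (\<phi> f) \<le> 2 * b"
proof -
  have re: "(\<lambda>x. of_real (Re (f x))) \<in> cont_functions A X"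
    by (rule cont_functions_compose[OF f, of "\<lambda>z. of_real (Re z)"]) (auto intro!: continuous_intros)
  have im: "(\<lambda>x. of_real (Im (f x))) \<in> cont_functions A X"
    by (rule cont_functions_compose[OF f, of "\<lambda>z. of_real (Im z)"]) (auto intro!: continuous_intros)
  have f_eq: "f = (\<lambda>x. of_real (Re (f x)) + \<i> * of_real (Im (f x)))"
    using complex_eq by blast
  have "\<phi> f = \<phi> (\<lambda>x. of_real (Re (f x))) + \<phi> (\<lambda>x. \<i> * of_real (Im (f x)))"
    by (subst f_eq) (rule state_add[OF \<phi> re cont_functions_scale[OF im]])
  also have "\<phi> (\<lambda>x. \<i> * of_real (Im (f x))) = \<i> * \<phi> (\<lambda>x. of_real (Im (f x)))"
    by (rule state_scale[OF \<phi> im])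
  finally have "cmod (\<phi> f) \<le> cmod (\<phi> (\<lambda>x. of_real (Re (f x)))) + cmod (\<phi> (\<lambda>x. of_real (Im (f x))))"
    using norm_triangle_ineq[of "\<phi> (\<lambda>x. of_real (Re (f x)))" "\<i> * \<phi> (\<lambda>x. of_real (Im (f x)))"]
    by (simp add: norm_mult)
  also have "cmod (\<phi> (\<lambda>x. of_real (Re (f x)))) \<le> b"
    using b abs_Re_le_cmod order_trans by (intro cmod_state_real_le[OF \<phi> re]) blast
  also have "cmod (\<phi> (\<lambda>x. of_real (Im (f x)))) \<le> b"
    using b abs_Im_le_cmod order_trans by (intro cmod_state_real_le[OF \<phi> im]) blast
  finally show ?thesis by simp
qed

text \<open>States move by little when the function does; this is how approximations in the supremum norm are used.\<close>

lemma cmod_states_diff_le: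
  assumes \<phi>: "\<phi> \<in> states A X" and \<psi>: "\<psi> \<in> states A X"
    and f: "f \<in> cont_functions A X" and g: "g \<in> cont_functions A X"
    and b: "\<And>x. x \<in> X \<Longrightarrow> cmod (f x - g x) \<le> b"
  shows "cmod (\<phi> f - \<psi> f) \<le> cmod (\<phi> g - \<psi> g) + 4 * b"
proof -
  note fg = cont_functions_diff[OF f g]
  let ?u = "\<lambda>x. f x - g x"
  have "\<phi> f - \<psi> f = (\<phi> g - \<psi> g) + (\<phi> ?u - \<psi> ?u)"
    using state_diff[OF \<phi> f g] state_diff[OF \<psi> f g] by simp
  also have "cmod \<dots> \<le> cmod (\<phi> g - \<psi> g) + cmod (\<phi> ?u - \<psi> ?u)"
    by (rule norm_triangle_ineq)
  also have "cmod (\<phi> ?u - \<psi> ?u) \<le> cmod (\<phi> ?u) + cmod (\<psi> ?u)"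
    by (rule norm_triangle_ineq4)
  also have "cmod (\<phi> ?u) \<le> 2 * b" by (rule cmod_state_le[OF \<phi> fg b])
  also have "cmod (\<psi> ?u) \<le> 2 * b" by (rule cmod_state_le[OF \<psi> fg b])
  finally show ?thesis by simp
qed

lemma connes_dist_le:
  assumes "\<And>f. f \<in> cyl_functions X \<Longrightarrow> commutator_norm X M f \<le> 1 \<Longrightarrow> cmod (\<phi> f - \<psi> f) \<le> b"
  shows "connes_dist X M \<phi> \<psi> \<le> ennreal b"
  unfolding connes_dist_def using assms by (intro SUP_least ennreal_leI) auto

lemma connes_dist_ge:
  assumes "f \<in> cyl_functions X" "commutator_norm X M f \<le> 1"
  shows "ennreal (cmod (\<phi> f - \<psi> f)) \<le> connes_dist X M \<phi> \<psi>"
  unfolding connes_dist_def using assms by (intro SUP_upper) auto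

lemma connes_dist_commute: "connes_dist X M \<phi> \<psi> = connes_dist X M \<psi> \<phi>"
  by (simp add: connes_dist_def norm_minus_commute)

lemma connes_dist_triangle: "connes_dist X M \<phi> \<omega> \<le> connes_dist X M \<phi> \<psi> + connes_dist X M \<psi> \<omega>"
  unfolding connes_dist_def[of X M \<phi> \<omega>]
proof (rule SUP_least)
  fix f assume "f \<in> {f \<in> cyl_functions X. commutator_norm X M f \<le> 1}"
  then have f: "f \<in> cyl_functions X" "commutator_norm X M f \<le> 1" by auto
  have "cmod (\<phi> f - \<omega> f) \<le> cmod (\<phi> f - \<psi> f) + cmod (\<psi> f - \<omega> f)"
    using norm_triangle_ineq[of "\<phi> f - \<psi> f" "\<psi> f - \<omega> f"] by simp
  then have "ennreal (cmod (\<phi> f - \<omega> f)) \<le> ennreal (cmod (\<phi> f - \<psi> f)) + ennreal (cmod (\<psi> f - \<omega> f))"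
    by (metis ennreal_leI ennreal_plus norm_ge_zero)
  also have "\<dots> \<le> connes_dist X M \<phi> \<psi> + connes_dist X M \<psi> \<omega>"
    by (intro add_mono connes_dist_ge f)
  finally show "ennreal (cmod (\<phi> f - \<omega> f)) \<le> connes_dist X M \<phi> \<psi> + connes_dist X M \<psi> \<omega>" .
qed

lemma topspace_weak_star_topology: "topspace (weak_star_topology A X) = states A X"
  by (auto simp: weak_star_topology_def states_def PiE_def)

lemma weak_star_neighbourhood:
  assumes "\<phi> \<in> states A X" "finite F" "F \<subseteq> cont_functions A X"
  shows "openin (weak_star_topology A X) {\<psi> \<in> states A X. \<forall>f\<in>F. cmod (\<phi> f - \<psi> f) < \<delta>}"
  using assms(2,3)
proof (induction F rule: finite_induct)
  case empty
  show ?case using openin_topspace[of "weak_star_topology A X"] by (simp add: topspace_weak_star_topology)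
next
  case (insert f F)
  have cont: "continuous_map (weak_star_topology A X) euclidean (\<lambda>\<psi>. \<psi> f)"
    unfolding weak_star_topology_def using insert.prems
    by (intro continuous_map_from_subtopology continuous_map_product_projection) simp
  have "openin (weak_star_topology A X) {\<psi> \<in> topspace (weak_star_topology A X). \<psi> f \<in> ball (\<phi> f) \<delta>}"
    by (rule openin_continuous_map_preimage[OF cont]) simp
  then have "openin (weak_star_topology A X) ({\<psi> \<in> states A X. \<psi> f \<in> ball (\<phi> f) \<delta>}
      \<inter> {\<psi> \<in> states A X. \<forall>f\<in>F. cmod (\<phi> f - \<psi> f) < \<delta>})"
    using insert by (intro openin_Int) (auto simp: topspace_weak_star_topology)
  also have "{\<psi> \<in> states A X. \<psi> f \<in> ball (\<phi> f) \<delta>} \<inter> {\<psi> \<in> states A X. \<forall>f\<in>F. cmod (\<phi> f - \<psi> f) < \<delta>}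
      = {\<psi> \<in> states A X. \<forall>f\<in>insert f F. cmod (\<phi> f - \<psi> f) < \<delta>}"
    by (auto simp: dist_norm)
  finally show ?case .
qed

section \<open>Finiteness and topology of the Connes distance\<close>

locale recurrent_spectral_triple = linearly_recurrent_words X R + cell_measure M X R
  for X :: "(int \<Rightarrow> 'a) set" and R :: nat and M :: "(int \<Rightarrow> 'a) measure" +
  fixes A :: "'a set"
  assumes finite_alphabet: "finite A" and subshift: "subshift A X"
begin

abbreviation S :: "(((int \<Rightarrow> 'a) \<Rightarrow> complex) \<Rightarrow> complex) set" where
  "S \<equiv> states A X"

abbreviation d :: "(((int \<Rightarrow> 'a) \<Rightarrow> complex) \<Rightarrow> complex) \<Rightarrow> (((int \<Rightarrow> 'a) \<Rightarrow> complex) \<Rightarrow> complex) \<Rightarrow> real" where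
  "d \<phi> \<psi> \<equiv> enn2real (connes_dist X M \<phi> \<psi>)"

definition lipschitz_ball :: "((int \<Rightarrow> 'a) \<Rightarrow> complex) set" where
  "lipschitz_ball = {f \<in> cyl_functions X. commutator_norm X M f \<le> 1}"

lemmas topspace_X = topspace_subshift_top[OF subshift]

lemma cyl_functions_iff: "f \<in> cyl_functions X \<longleftrightarrow> (\<exists>n. f \<in> C n)"
proof
  assume "f \<in> cyl_functions X"
  then obtain k where k: "-1 \<le> k" "f \<in> cyl_space X k" by (auto simp: cyl_functions_def)
  show "\<exists>n. f \<in> C n"
  proof (cases "k < 0")
    case True
    then have "f = (\<lambda>_. 0)" using k(2) by (simp add: cyl_space_def)
    then show ?thesis using C_zero by blast
  next
    case False
    then show ?thesis using k(2) by (metis int_nat_eq not_less)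
  qed
next
  assume "\<exists>n. f \<in> C n"
  then show "f \<in> cyl_functions X" by (force simp: cyl_functions_def)
qed

lemma C_cont_functions:
  assumes f: "f \<in> C n"
  shows "f \<in> cont_functions A X"
proof -
  have "openin (subshift_top A X) {x \<in> topspace (subshift_top A X). f x \<in> U}" for U
  proof -
    have "{x \<in> topspace (subshift_top A X). f x \<in> U} = (\<Union>x\<in>{x \<in> X. f x \<in> U}. cell X n x)"
    proof (intro equalityI subsetI)
      fix y assume "y \<in> (\<Union>x\<in>{x \<in> X. f x \<in> U}. cell X n x)"
      then obtain x where x: "x \<in> X" "f x \<in> U" "y \<in> cell X n x" by blast
      then have "f y \<in> U" using C_const[OF f x(1,3)] by simp
      then show "y \<in> {x \<in> topspace (subshift_top A X). f x \<in> U}"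
        using x(3) unfolding topspace_X by (simp add: cell_def)
    next
      fix y assume "y \<in> {x \<in> topspace (subshift_top A X). f x \<in> U}"
      then show "y \<in> (\<Union>x\<in>{x \<in> X. f x \<in> U}. cell X n x)"
        unfolding topspace_X using cell_refl by fast
    qed
    also have "openin (subshift_top A X) \<dots>"
      by (intro openin_Union) (auto intro: openin_cell[OF subshift])
    finally show ?thesis .
  qed
  then show ?thesis using C_vanish[OF f] by (auto simp: cont_functions_def continuous_map_def)
qed

lemma lipschitz_ball_cont_functions: "f \<in> lipschitz_ball \<Longrightarrow> f \<in> cont_functions A X"
  using cyl_functions_iff C_cont_functions by (auto simp: lipschitz_ball_def)

text \<open>This is the total boundedness behind the theorem: up to a uniform error \<open>\<epsilon>\<close>, the whole ball lies
  in one finite-dimensional space \<open>C N\<close>.\<close>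

lemma lipschitz_ball_near_C:
  assumes \<epsilon>: "0 < \<epsilon>"
  shows "\<exists>N. \<forall>f\<in>lipschitz_ball. \<forall>x\<in>X. cmod (f x - avg N f x) \<le> \<epsilon>"
proof -
  obtain N where N: "\<And>x n. x \<in> X \<Longrightarrow>
      (\<Sum>j | N \<le> j \<and> j < n \<and> cell X (Suc j) x \<noteq> cell X j x. 1 / real (Suc j)) \<le> \<epsilon>\<^sup>2 / real R"
    using sum_splits_small[of "\<epsilon>\<^sup>2 / real R"] \<epsilon> R_pos by auto
  have "cmod (f x - avg N f x) \<le> \<epsilon>" if f: "f \<in> lipschitz_ball" and x: "x \<in> X" for f x
  proof -
    obtain n where n: "f \<in> C n" using f cyl_functions_iff by (auto simp: lipschitz_ball_def)
    have "(cmod (f x - avg N f x))\<^sup>2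
        \<le> real R * (\<Sum>j | N \<le> j \<and> j < n \<and> cell X (Suc j) x \<noteq> cell X j x. 1 / real (Suc j))"
      using f by (intro pointwise_deviation[OF n _ x]) (simp add: lipschitz_ball_def)
    also have "\<dots> \<le> real R * (\<epsilon>\<^sup>2 / real R)"
      by (intro mult_left_mono N x) simp
    also have "\<dots> = \<epsilon>\<^sup>2" using R_pos by simp
    finally show ?thesis by (rule power2_le_imp_le) (use \<epsilon> in simp)
  qed
  then show ?thesis by blast
qed

text \<open>The same estimate as for \<open>lipschitz_ball_near_C\<close>, but from length 0 on, where the first \<open>N\<close> increments are all
  counted as if they were splittings.  The function \<open>avg 0 f\<close> is a constant.\<close>

lemma lipschitz_ball_bounded_mod_constants:
  "\<exists>B>0. \<forall>f\<in>lipschitz_ball. \<forall>x\<in>X. cmod (f x - avg 0 f x) \<le> B"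
proof -
  obtain N where N: "\<And>x n. x \<in> X \<Longrightarrow>
      (\<Sum>j | N \<le> j \<and> j < n \<and> cell X (Suc j) x \<noteq> cell X j x. 1 / real (Suc j)) \<le> 1"
    using sum_splits_small[of 1] by auto
  have "cmod (f x - avg 0 f x) \<le> real R * (real N + 1) + 1" if f: "f \<in> lipschitz_ball" and x: "x \<in> X" for f x
  proof -
    obtain n where n: "f \<in> C n" using f cyl_functions_iff by (auto simp: lipschitz_ball_def)
    let ?T = "{j. N \<le> j \<and> j < n \<and> cell X (Suc j) x \<noteq> cell X j x}"
    have fin: "finite ?T" by (rule finite_subset[of _ "{..<n}"]) auto
    have "(\<Sum>j | 0 \<le> j \<and> j < n \<and> cell X (Suc j) x \<noteq> cell X j x. 1 / real (Suc j))
        \<le> (\<Sum>j\<in>{..<N} \<union> ?T. 1 / real (Suc j))"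
      using fin by (intro sum_mono2) auto
    also have "\<dots> = (\<Sum>j<N. 1 / real (Suc j)) + (\<Sum>j\<in>?T. 1 / real (Suc j))"
      using fin by (intro sum.union_disjoint) auto
    also have "(\<Sum>j<N. 1 / real (Suc j)) \<le> (\<Sum>j<N. 1)"
      by (intro sum_mono) simp
    also have "(\<Sum>j\<in>?T. 1 / real (Suc j)) \<le> 1" by (rule N[OF x])
    finally have le: "(\<Sum>j | 0 \<le> j \<and> j < n \<and> cell X (Suc j) x \<noteq> cell X j x. 1 / real (Suc j)) \<le> real N + 1"
      by simp
    have "(cmod (f x - avg 0 f x))\<^sup>2
        \<le> real R * (\<Sum>j | 0 \<le> j \<and> j < n \<and> cell X (Suc j) x \<noteq> cell X j x. 1 / real (Suc j))"
      using f by (intro pointwise_deviation[OF n _ x]) (simp add: lipschitz_ball_def)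
    also have "\<dots> \<le> real R * (real N + 1)" using le by (intro mult_left_mono) auto
    also have "\<dots> \<le> (real R * (real N + 1) + 1)\<^sup>2"
      by (simp add: power2_eq_square algebra_simps add_increasing)
    finally show ?thesis by (rule power2_le_imp_le) simp
  qed
  then show ?thesis
    by (intro exI[of _ "real R * (real N + 1) + 1"]) (simp add: add_nonneg_pos)
qed

lemma states_agree_on_avg_0:
  assumes "\<phi> \<in> S" "\<psi> \<in> S"
  shows "\<phi> (avg 0 f) = \<psi> (avg 0 f)"
proof -
  have "avg 0 f = (\<lambda>x. (LINT y|M. f y * indicator X y) * indicator X x)"
    using prob_space[unfolded space_eq] by (auto simp: avg_def cell_0 fun_eq_iff)
  then show ?thesis
    by (simp only: state_scale[OF assms(1) cont_functions_indicator] state_unit[OF assms(1)]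
        state_scale[OF assms(2) cont_functions_indicator] state_unit[OF assms(2)])
qed

lemma connes_dist_finite:
  assumes "\<phi> \<in> S" "\<psi> \<in> S"
  shows "connes_dist X M \<phi> \<psi> < \<infinity>"
proof -
  obtain B where B: "\<And>f x. f \<in> lipschitz_ball \<Longrightarrow> x \<in> X \<Longrightarrow> cmod (f x - avg 0 f x) \<le> B"
    using lipschitz_ball_bounded_mod_constants by blast
  have "connes_dist X M \<phi> \<psi> \<le> ennreal (4 * B)"
  proof (rule connes_dist_le)
    fix f assume "f \<in> cyl_functions X" "commutator_norm X M f \<le> 1"
    then have f: "f \<in> lipschitz_ball" by (simp add: lipschitz_ball_def)
    show "cmod (\<phi> f - \<psi> f) \<le> 4 * B"
      using cmod_states_diff_le[OF assms lipschitz_ball_cont_functions[OF f]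
          C_cont_functions[OF avg_in_C[of 0 f]] B[OF f]] states_agree_on_avg_0[OF assms, of f] by simp
  qed
  then show ?thesis by (simp add: le_less_trans ennreal_less_top)
qed

text \<open>A small positive multiple of \<open>h\<close> is admissible in the supremum that defines the distance.  This is the reason why
  the distance separates states and why its topology refines the weak-* topology.\<close>

lemma C_lipschitz:
  assumes h: "h \<in> C n"
  shows "\<exists>c>0. \<forall>\<phi>\<in>S. \<forall>\<psi>\<in>S. cmod (\<phi> h - \<psi> h) \<le> c * d \<phi> \<psi>"
proof -
  obtain \<delta> where \<delta>: "0 < \<delta>" "\<And>f. f \<in> C n \<Longrightarrow> (\<And>x. cmod (f x) \<le> \<delta>) \<Longrightarrow> commutator_norm X M f \<le> 1"
    using commutator_norm_le_1_if_small[of n] by blast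
  obtain b where b: "0 \<le> b" "\<And>x. cmod (h x) \<le> b" using C_bounded[OF h] by blast
  define t where "t = \<delta> / (b + 1)"
  have t: "0 < t" using \<delta>(1) b(1) by (simp add: t_def)
  define f where "f x = of_real t * h x" for x
  have f: "f \<in> C n" unfolding f_def[abs_def] by (rule C_scale[OF h])
  have "commutator_norm X M f \<le> 1"
  proof (rule \<delta>(2)[OF f])
    fix x
    have "cmod (f x) = t * cmod (h x)" using t by (simp add: f_def norm_mult)
    also have "\<dots> \<le> t * (b + 1)" using b(2)[of x] t by (intro mult_left_mono) auto
    also have "\<dots> = \<delta>" using b(1) by (simp add: t_def)
    finally show "cmod (f x) \<le> \<delta>" .
  qed
  then have ge: "ennreal (cmod (\<phi> f - \<psi> f)) \<le> connes_dist X M \<phi> \<psi>" for \<phi> \<psi>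
    using f cyl_functions_iff by (intro connes_dist_ge) auto
  have "cmod (\<phi> h - \<psi> h) \<le> 1 / t * d \<phi> \<psi>" if "\<phi> \<in> S" "\<psi> \<in> S" for \<phi> \<psi>
  proof -
    have "\<phi> f - \<psi> f = of_real t * (\<phi> h - \<psi> h)"
      unfolding f_def[abs_def]
      using state_scale[OF that(1) C_cont_functions[OF h]] state_scale[OF that(2) C_cont_functions[OF h]]
      by (simp add: right_diff_distrib)
    then have "t * cmod (\<phi> h - \<psi> h) = cmod (\<phi> f - \<psi> f)" using t by (simp add: norm_mult)
    also have "\<dots> \<le> d \<phi> \<psi>"
      using enn2real_mono[OF ge connes_dist_finite[OF that, unfolded infinity_ennreal_def]] by simp
    finally show ?thesis using t by (simp add: field_simps)
  qed
  then show ?thesis using t by (intro exI[of _ "1 / t"]) simp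
qed

lemma C_dense:
  assumes g: "g \<in> cont_functions A X" and \<epsilon>: "0 < \<epsilon>"
  shows "\<exists>n h. h \<in> C n \<and> (\<forall>x\<in>X. cmod (g x - h x) \<le> \<epsilon>)"
proof -
  have "continuous_map (subshift_top A X) euclidean g" using g by (simp add: cont_functions_def)
  from uniform_approximation_by_cells[OF finite_alphabet subshift this \<epsilon>]
  obtain n where n: "\<And>x y. x \<in> X \<Longrightarrow> y \<in> cell X n x \<Longrightarrow> cmod (g y - g x) < \<epsilon>" by blast
  define h where "h x = (if x \<in> X then g (rep (cell X n x)) else 0)" for x
  have "h \<in> C n"
  proof (rule C_I)
    fix x y assume "x \<in> X" and y: "y \<in> cell X n x"
    then show "h y = h x" by (simp add: h_def cell_eqI[OF y]) (simp add: cell_def)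
  qed (simp add: h_def)
  moreover have "cmod (g x - h x) \<le> \<epsilon>" if x: "x \<in> X" for x
    using n[OF x rep_in[OF x]] x by (simp add: h_def norm_minus_commute less_imp_le)
  ultimately show ?thesis by blast
qed

lemma Metric_space_connes_dist: "Metric_space S d"
proof
  show "0 \<le> d \<phi> \<psi>" for \<phi> \<psi> by simp
  show "d \<phi> \<psi> = d \<psi> \<phi>" for \<phi> \<psi> by (simp add: connes_dist_commute)
  show "d \<phi> \<omega> \<le> d \<phi> \<psi> + d \<psi> \<omega>" if "\<phi> \<in> S" "\<psi> \<in> S" "\<omega> \<in> S" for \<phi> \<psi> \<omega>
  proof -
    have lt: "connes_dist X M \<phi> \<psi> < top" "connes_dist X M \<psi> \<omega> < top"
      using connes_dist_finite that by (simp_all add: infinity_ennreal_def)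
    have "d \<phi> \<omega> \<le> enn2real (connes_dist X M \<phi> \<psi> + connes_dist X M \<psi> \<omega>)"
      using lt by (intro enn2real_mono connes_dist_triangle) simp
    also have "\<dots> = d \<phi> \<psi> + d \<psi> \<omega>" using lt by (rule enn2real_plus)
    finally show ?thesis .
  qed
  show "d \<phi> \<psi> = 0 \<longleftrightarrow> \<phi> = \<psi>" if \<phi>\<psi>: "\<phi> \<in> S" "\<psi> \<in> S" for \<phi> \<psi>
  proof
    assume "\<phi> = \<psi>"
    then have "connes_dist X M \<phi> \<psi> \<le> ennreal 0" by (intro connes_dist_le) simp
    then show "d \<phi> \<psi> = 0" by simp
  next
    assume d0: "d \<phi> \<psi> = 0"
    have "\<phi> g = \<psi> g" if g: "g \<in> cont_functions A X" for g
    proof -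
      have "cmod (\<phi> g - \<psi> g) \<le> 0 + \<epsilon>" if \<epsilon>: "0 < \<epsilon>" for \<epsilon>
      proof -
        obtain n h where h: "h \<in> C n" "\<And>x. x \<in> X \<Longrightarrow> cmod (g x - h x) \<le> \<epsilon> / 4"
          using C_dense[OF g, of "\<epsilon> / 4"] \<epsilon> by auto
        obtain c where "cmod (\<phi> h - \<psi> h) \<le> c * d \<phi> \<psi>" using C_lipschitz[OF h(1)] \<phi>\<psi> by blast
        then show ?thesis
          using cmod_states_diff_le[OF \<phi>\<psi> g C_cont_functions[OF h(1)] h(2)] d0 by simp
      qed
      then have "cmod (\<phi> g - \<psi> g) \<le> 0" by (rule field_le_epsilon)
      then show ?thesis by simp
    qed
    then show "\<phi> = \<psi>"
      using \<phi>\<psi> by (intro extensionalityI[of _ "cont_functions A X"]) (auto simp: states_def)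
  qed
qed

interpretation connes: Metric_space S d
  by (rule Metric_space_connes_dist)

text \<open>Modulo constants, on which all states agree, \<open>avg N f\<close> has norm at most \<open>B + r / 16\<close>, so its
  coefficients along the finitely many cell indicators are bounded uniformly in \<open>f\<close>; control of the
  states on these indicators therefore controls them on the whole ball.\<close>

lemma weak_star_neighbourhood_in_mball:
  assumes \<phi>: "\<phi> \<in> S" and r: "0 < r"
  shows "\<exists>V. openin (weak_star_topology A X) V \<and> \<phi> \<in> V \<and> V \<subseteq> connes.mball \<phi> r"
proof -
  obtain B where B: "0 < B" "\<And>f x. f \<in> lipschitz_ball \<Longrightarrow> x \<in> X \<Longrightarrow> cmod (f x - avg 0 f x) \<le> B"
    using lipschitz_ball_bounded_mod_constants by blast
  obtain N where N: "\<And>f x. f \<in> lipschitz_ball \<Longrightarrow> x \<in> X \<Longrightarrow> cmod (f x - avg N f x) \<le> r / 16"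
    using lipschitz_ball_near_C[of "r / 16"] r by auto
  define F :: "((int \<Rightarrow> 'a) \<Rightarrow> complex) set" where "F = indicator ` cell X N ` X"
  have F: "finite F" "F \<subseteq> cont_functions A X"
    using finite_partition C_cont_functions[OF C_indicator_cell] by (auto simp: F_def)
  define m where "m = real (card (cell X N ` X))"
  define W where "W = B + r / 16"
  have W: "0 < W" using B(1) r by (simp add: W_def)
  define \<delta> where "\<delta> = r / (2 * (m * W + 1))"
  have mW: "0 < m * W + 1" using W by (simp add: m_def add_nonneg_pos)
  have \<delta>: "0 < \<delta>" using r mW by (simp add: \<delta>_def)
  have mW\<delta>: "m * W * \<delta> \<le> r / 2"
  proof -
    have "2 * (m * W + 1) * \<delta> = r" using mW by (simp add: \<delta>_def)
    then show ?thesis using \<delta> by (simp add: algebra_simps)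
  qed
  define V where "V = {\<psi> \<in> S. \<forall>f\<in>F. cmod (\<phi> f - \<psi> f) < \<delta>}"
  have "V \<subseteq> connes.mball \<phi> r"
  proof
    fix \<psi> assume "\<psi> \<in> V"
    then have \<psi>: "\<psi> \<in> S"
      and close: "\<And>U. U \<in> cell X N ` X \<Longrightarrow> cmod (\<phi> (indicator U) - \<psi> (indicator U)) < \<delta>"
      by (auto simp: V_def F_def)
    have "connes_dist X M \<phi> \<psi> \<le> ennreal (3 * r / 4)"
    proof (rule connes_dist_le)
      fix f assume "f \<in> cyl_functions X" "commutator_norm X M f \<le> 1"
      then have f: "f \<in> lipschitz_ball" by (simp add: lipschitz_ball_def)
      define g where "g x = avg N f x - avg 0 f x" for x
      have gC: "g \<in> C N"
        unfolding g_def[abs_def] by (intro C_diff avg_in_C C_mono[OF _ avg_in_C]) simp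
      have g_eq: "\<omega> g = (\<Sum>U\<in>cell X N ` X. g (rep U) * \<omega> (indicator U))" if \<omega>: "\<omega> \<in> S" for \<omega>
      proof -
        have "\<omega> g = \<omega> (\<lambda>x. \<Sum>U\<in>cell X N ` X. g (rep U) * indicator U x)"
          using C_expand[OF gC] by (intro arg_cong[of _ _ \<omega>] ext)
        also have "\<dots> = (\<Sum>U\<in>cell X N ` X. g (rep U) * \<omega> (indicator U))"
          using C_cont_functions[OF C_indicator_cell] by (intro state_sum[OF \<omega> finite_partition]) auto
        finally show ?thesis .
      qed
      have g_le: "cmod (g (rep U)) \<le> W" if "U \<in> cell X N ` X" for U
      proof -
        have x: "rep U \<in> X" using that rep_in by (auto simp: cell_def)
        have "g (rep U) = (f (rep U) - avg 0 f (rep U)) - (f (rep U) - avg N f (rep U))" by (simp add: g_def)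
        then have "cmod (g (rep U)) \<le> cmod (f (rep U) - avg 0 f (rep U)) + cmod (f (rep U) - avg N f (rep U))"
          by (metis norm_triangle_ineq4)
        then show ?thesis using B(2)[OF f x] N[OF f x] by (simp add: W_def)
      qed
      have "\<phi> g - \<psi> g = (\<Sum>U\<in>cell X N ` X. g (rep U) * (\<phi> (indicator U) - \<psi> (indicator U)))"
        by (simp add: g_eq[OF \<phi>] g_eq[OF \<psi>] right_diff_distrib sum_subtractf)
      also have "cmod \<dots> \<le> (\<Sum>U\<in>cell X N ` X. W * \<delta>)"
      proof (intro order_trans[OF norm_sum] sum_mono)
        fix U assume U: "U \<in> cell X N ` X"
        show "cmod (g (rep U) * (\<phi> (indicator U) - \<psi> (indicator U))) \<le> W * \<delta>"
          unfolding norm_mult using g_le[OF U] close[OF U] W by (intro mult_mono) auto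
      qed
      also have "\<dots> \<le> r / 2" using mW\<delta> by (simp add: m_def)
      finally have g_small: "cmod (\<phi> g - \<psi> g) \<le> r / 2" .
      have cont: "avg N f \<in> cont_functions A X" "avg 0 f \<in> cont_functions A X"
        by (rule C_cont_functions[OF avg_in_C])+
      have "\<phi> (avg N f) - \<psi> (avg N f) = \<phi> g - \<psi> g"
        unfolding g_def[abs_def]
        using state_diff[OF \<phi> cont] state_diff[OF \<psi> cont] states_agree_on_avg_0[OF \<phi> \<psi>, of f] by simp
      then show "cmod (\<phi> f - \<psi> f) \<le> 3 * r / 4"
        using cmod_states_diff_le[OF \<phi> \<psi> lipschitz_ball_cont_functions[OF f] cont(1) N[OF f]] g_small by simp
    qed
    then have "d \<phi> \<psi> \<le> 3 * r / 4"
      using r enn2real_mono[of "connes_dist X M \<phi> \<psi>" "ennreal (3 * r / 4)"] by simp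
    then show "\<psi> \<in> connes.mball \<phi> r" using \<phi> \<psi> r by simp
  qed
  moreover have "openin (weak_star_topology A X) V"
    unfolding V_def by (rule weak_star_neighbourhood[OF \<phi> F])
  moreover have "\<phi> \<in> V" using \<phi> \<delta> by (simp add: V_def)
  ultimately show ?thesis by blast
qed

text \<open>Approximate \<open>g\<close> by some \<open>h \<in> C n\<close>, at which evaluation is Lipschitz.\<close>

lemma continuous_evaluation:
  assumes g: "g \<in> cont_functions A X"
  shows "continuous_map connes.mtopology euclidean (\<lambda>\<phi>. \<phi> g)"
proof -
  have "openin connes.mtopology {\<phi> \<in> S. \<phi> g \<in> T}" if T: "open T" for T
    unfolding connes.openin_mtopology
  proof (intro conjI allI impI)
    fix \<phi> assume "\<phi> \<in> {\<phi> \<in> S. \<phi> g \<in> T}"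
    then obtain e where e: "0 < e" "ball (\<phi> g) e \<subseteq> T" and \<phi>: "\<phi> \<in> S"
      using T open_contains_ball by blast
    obtain n h where h: "h \<in> C n" "\<And>x. x \<in> X \<Longrightarrow> cmod (g x - h x) \<le> e / 8"
      using C_dense[OF g, of "e / 8"] e(1) by auto
    obtain c where c: "0 < c" "\<And>\<psi>. \<psi> \<in> S \<Longrightarrow> cmod (\<phi> h - \<psi> h) \<le> c * d \<phi> \<psi>"
      using C_lipschitz[OF h(1)] \<phi> by blast
    have "connes.mball \<phi> (e / (2 * c)) \<subseteq> {\<phi> \<in> S. \<phi> g \<in> T}"
    proof
      fix \<psi> assume "\<psi> \<in> connes.mball \<phi> (e / (2 * c))"
      then have \<psi>: "\<psi> \<in> S" "d \<phi> \<psi> < e / (2 * c)" by auto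
      then have "c * d \<phi> \<psi> < e / 2" using c(1) by (simp add: field_simps)
      then have "cmod (\<phi> g - \<psi> g) < e"
        using cmod_states_diff_le[OF \<phi> \<psi>(1) g C_cont_functions[OF h(1)] h(2)] c(2)[OF \<psi>(1)] by simp
      then show "\<psi> \<in> {\<phi> \<in> S. \<phi> g \<in> T}" using \<psi>(1) e(2) by (auto simp: dist_norm)
    qed
    then show "\<exists>r>0. connes.mball \<phi> r \<subseteq> {\<phi> \<in> S. \<phi> g \<in> T}"
      using e(1) c(1) by (intro exI[of _ "e / (2 * c)"]) simp
  qed auto
  then show ?thesis by (simp add: continuous_map_def)
qed

lemma mtopology_eq_weak_star: "connes.mtopology = weak_star_topology A X"
proof -
  have "openin (weak_star_topology A X) U" if U: "openin connes.mtopology U" for U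
  proof (subst openin_subopen, intro ballI)
    fix \<phi> assume "\<phi> \<in> U"
    then obtain r where "0 < r" "connes.mball \<phi> r \<subseteq> U" "\<phi> \<in> S"
      using U connes.openin_mtopology by blast
    then show "\<exists>T. openin (weak_star_topology A X) T \<and> \<phi> \<in> T \<and> T \<subseteq> U"
      using weak_star_neighbourhood_in_mball[of \<phi> r] by blast
  qed
  moreover have "openin connes.mtopology U" if U: "openin (weak_star_topology A X) U" for U
  proof -
    have "continuous_map connes.mtopology (weak_star_topology A X) id"
      unfolding weak_star_topology_def continuous_map_in_subtopology continuous_map_componentwise
      using continuous_evaluation states_subset_extensional[of A X] by auto
    from openin_continuous_map_preimage[OF this U]
    have "openin connes.mtopology {\<phi> \<in> S. \<phi> \<in> U}" by simp
    moreover have "{\<phi> \<in> S. \<phi> \<in> U} = U"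
      using openin_subset[OF U] by (auto simp: topspace_weak_star_topology)
    ultimately show ?thesis by simp
  qed
  ultimately show ?thesis by (auto simp: topology_eq)
qed

end

theorem theorem5p10:
  fixes A :: "'a set" and X :: "(int \<Rightarrow> 'a) set" and M :: "(int \<Rightarrow> 'a) measure"
  assumes "finite A"
    and "linearly_recurrent A X"
    and "invariant_prob_measure A X M"
  shows "(\<forall>\<phi>\<in>states A X. \<forall>\<psi>\<in>states A X. connes_dist X M \<phi> \<psi> < \<infinity>) \<and>
         Metric_space (states A X) (\<lambda>\<phi> \<psi>. enn2real (connes_dist X M \<phi> \<psi>)) \<and>
         Metric_space.mtopology (states A X) (\<lambda>\<phi> \<psi>. enn2real (connes_dist X M \<phi> \<psi>))
           = weak_star_topology A X"
proof -
  obtain R where R: "linearly_recurrent_words X R" "cell_measure M X R"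
    using cell_measure_of_linearly_recurrent[OF assms] .
  interpret linearly_recurrent_words X R by fact
  interpret cell_measure M X R by fact
  interpret recurrent_spectral_triple X R M A
    by unfold_locales
      (use assms(1,2) in \<open>simp_all add: linearly_recurrent_def minimal_subshift_def\<close>)
  show ?thesis
    using connes_dist_finite Metric_space_connes_dist mtopology_eq_weak_star by blast
qed

end
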